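(* Let $\nu\ge2$. There exists a constant $C=C(\nu)>0$ such that the following holds. Let $\epsilon>0$, $\delta\in(0,1)$ and $N=2^n$ ($n\in\mathbb N$) be such that $\delta^\epsilon N=2^m$ for some integer $0\le m\le n$ (so that $\delta^{-\epsilon}\in\mathbb N$), and let $P\in\mathcal D_N$ be a permutation which is constant on the tiling $\mathcal R_{\delta^{-\epsilon}}$ (whose cubes have side $\delta^\epsilon$). Then $$\mathrm{dist}_{\mathcal D_N}(P,\mathrm{Id})\le C\,\delta^\epsilon.$$
   Context: For $N\in\mathbb N$, $\mathcal R_N$ is the tiling of $[0,1]^\nu$ by $N^\nu$ closed axis-parallel cubes of side $N^{-1}$; $c(\kappa)$ is the center of a cube $\kappa\in\mathcal R_N$. $\mathcal D_N$ is the group of permutations of $\mathcal R_N$: measure-preserving maps $P:[0,1]^\nu\to[0,1]^\nu$ (up to null sets) which send each cube of $\mathcal R_N$ onto a cube of $\mathcal R_N$ bijectively, by translation: $P(x)=x+c(P(\kappa))-c(\kappa)$ for $x\in\mathrm{int}(\kappa)$. A permutation $P\in\mathcal D_N$ is constant on the coarser tiling $\mathcal R_{\delta^{-\epsilon}}$ if for every $K\in\mathcal R_{\delta^{-\epsilon}}$ and every $\kappa\in\mathcal R_N$ with $\kappa\subset K$ one has $P(\kappa)\subset K$. A rectangle is a set $\prod_{i=1}^\nu[h_i/N,\tilde h_i/N]$ with integers $0\le h_i<\tilde h_i\le N$; an array $A$ is a rectangle which has side $1/N$ in all coordinate directions but one; its length $\ell(A)$ is the number of cubes of $\mathcal R_N$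 it contains, and we write $A=[\kappa_1,\dots,\kappa_{\ell(A)}]$ for its consecutive cubes. Sets are called disjoint if their interiors are disjoint. A sequence of $h$ swapping couples in an array $A=[\kappa_1,\dots,\kappa_{\ell(A)}]$ is given by indices $p_1<p_2<\dots<p_{2h}$, $2h\le\ell(A)$; its couples are $(\kappa_{p_j},\kappa_{p_{2h-j+1}})$, $j=1,\dots,h$ (nested couples). An elementary movement $Z:[0,1]^\nu\to[0,1]^\nu$ is given by pairwise disjoint arrays $A_1,\dots,A_m$ and, for each $i$, a sequence of $h(i)$ swapping couples in $A_i$: $Z$ exchanges by translation the two cubes of each couple, and is the identity elsewhere. Its cost is $L(Z)=\max_i\ell(A_i)\,N^{-1-\frac\nu2}\sqrt{\sum_{i=1}^m h(i)}$ (computed from the given arrays and couples). A discrete flow is a finite sequence $\{Z_k\}_{k=1}^T$ of elementary movements; its length is $\sum_{k=1}^T L(Z_k)$; it connects $P$ to $Q$ if $Z_T\circ\cdots\circ Z_1\circ P=Q$. $\mathrm{dist}_{\mathcal D_N}(P,Q)$ is the minimum of the lengths of all discrete flows connecting $P$ to $Q$ (it is $0$ if $P=Q$). *)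

theory Defs
  imports "HOL-Analysis.Analysis"
begin

text \<open>The dimension is \<open>CARD('n)\<close>, and points live in \<^typ>\<open>real ^ 'n\<close>. Maps of the unit cube are
  represented by total functions on \<^typ>\<open>real ^ 'n\<close>; only their values on the unit cube matter, and
  equality of permutations is almost-everywhere equality there.\<close>

definition unit_cube :: "(real ^ 'n) set" where
  "unit_cube = cbox 0 (\<chi> i. 1)"

definition grid_box :: "nat \<Rightarrow> ('n \<Rightarrow> nat) \<Rightarrow> ('n \<Rightarrow> nat) \<Rightarrow> (real ^ 'n) set" where
  "grid_box N h h' = cbox (\<chi> i. real (h i) / real N) (\<chi> i. real (h' i) / real N)"

definition rectangles :: "nat \<Rightarrow> (real ^ 'n) set set" where
  "rectangles N = {grid_box N h h' | h h'. \<forall>i. h i < h' i \<and> h' i \<le> N}"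

definition tiling :: "nat \<Rightarrow> (real ^ 'n) set set" where
  "tiling N = {grid_box N h (\<lambda>i. h i + 1) | h. \<forall>i. h i < N}"

definition center :: "(real ^ 'n) set \<Rightarrow> real ^ 'n" where
  "center \<kappa> = midpoint (interval_lowerbound \<kappa>) (interval_upperbound \<kappa>)"

text \<open>The cube \<open>P(\<kappa>)\<close>. As \<open>P\<close> is a translation only on the interior of \<open>\<kappa>\<close> (its values on the
  boundary are irrelevant), the closed image cube is recovered as a closure.\<close>

definition image_cube :: "(real ^ 'n \<Rightarrow> real ^ 'n) \<Rightarrow> (real ^ 'n) set \<Rightarrow> (real ^ 'n) set" where
  "image_cube P \<kappa> = closure (P ` interior \<kappa>)"

definition measure_preserving_cube :: "(real ^ 'n \<Rightarrow> real ^ 'n) \<Rightarrow> bool" where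
  "measure_preserving_cube P \<longleftrightarrow>
     P \<in> measurable (lebesgue_on unit_cube) (lebesgue_on unit_cube) \<and>
     distr (lebesgue_on unit_cube) (lebesgue_on unit_cube) P = lebesgue_on unit_cube"

definition cube_permutations :: "nat \<Rightarrow> (real ^ 'n \<Rightarrow> real ^ 'n) set" where
  "cube_permutations N = {P. measure_preserving_cube P \<and>
     bij_betw (image_cube P) (tiling N) (tiling N) \<and>
     (\<forall>\<kappa>\<in>tiling N. \<forall>x\<in>interior \<kappa>. P x = x + center (image_cube P \<kappa>) - center \<kappa>)}"

definition constant_on_tiling :: "nat \<Rightarrow> nat \<Rightarrow> (real ^ 'n \<Rightarrow> real ^ 'n) \<Rightarrow> bool" where
  "constant_on_tiling N M P \<longleftrightarrow>
     (\<forall>K\<in>tiling M. \<forall>\<kappa>\<in>tiling N. \<kappa> \<subseteq> K \<longrightarrow> image_cube P \<kappa> \<subseteq> K)"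

definition arrays :: "nat \<Rightarrow> (real ^ 'n) set set" where
  "arrays N = {grid_box N h h' | h h'.
     (\<forall>i. h i < h' i \<and> h' i \<le> N) \<and> (\<exists>d. \<forall>i. i \<noteq> d \<longrightarrow> h' i = h i + 1)}"

lemma arrays_subset_rectangles: "arrays N \<subseteq> rectangles N"
  unfolding arrays_def rectangles_def by blast

definition array_length :: "nat \<Rightarrow> (real ^ 'n) set \<Rightarrow> nat" where
  "array_length N A = card {\<kappa> \<in> tiling N. \<kappa> \<subseteq> A}"

text \<open>\<open>A = [\<kappa> 1, \<dots>, \<kappa> (\<ell>(A))]\<close>, listed in the direction of increasing coordinate. Listing the cubes
  backwards would give the same nested families of couples.\<close>

definition consecutive_cubes ::
    "nat \<Rightarrow> (real ^ 'n) set \<Rightarrow> (nat \<Rightarrow> (real ^ 'n) set) \<Rightarrow> bool" where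
  "consecutive_cubes N A \<kappa> \<longleftrightarrow>
     bij_betw \<kappa> {1..array_length N A} {c \<in> tiling N. c \<subseteq> A} \<and>
     (\<exists>d. \<forall>j. 1 \<le> j \<and> j < array_length N A \<longrightarrow>
        center (\<kappa> (j + 1)) = center (\<kappa> j) + axis d (1 / real N))"

definition swapping_indices :: "nat \<Rightarrow> nat \<Rightarrow> (nat \<Rightarrow> nat) \<Rightarrow> bool" where
  "swapping_indices l h p \<longleftrightarrow>
     2 * h \<le> l \<and> strict_mono_on {1..2 * h} p \<and> p ` {1..2 * h} \<subseteq> {1..l}"

definition swapping_couples ::
    "(nat \<Rightarrow> (real ^ 'n) set) \<Rightarrow> nat \<Rightarrow> (nat \<Rightarrow> nat) \<Rightarrow> ((real ^ 'n) set \<times> (real ^ 'n) set) set" where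
  "swapping_couples \<kappa> h p = {(\<kappa> (p j), \<kappa> (p (2 * h - j + 1))) | j. j \<in> {1..h}}"

text \<open>This determines \<open>Z\<close> completely: points outside the interiors of the exchanged cubes, including
  those on the boundaries of these cubes, are fixed.\<close>

definition exchanges ::
    "(real ^ 'n \<Rightarrow> real ^ 'n) \<Rightarrow> ((real ^ 'n) set \<times> (real ^ 'n) set) set \<Rightarrow> bool" where
  "exchanges Z S \<longleftrightarrow>
     (\<forall>(\<kappa>, \<kappa>')\<in>S. (\<forall>x\<in>interior \<kappa>. Z x = x + center \<kappa>' - center \<kappa>) \<and>
                   (\<forall>x\<in>interior \<kappa>'. Z x = x + center \<kappa> - center \<kappa>')) \<and>
     (\<forall>x. x \<notin> (\<Union>(\<kappa>, \<kappa>')\<in>S. interior \<kappa> \<union> interior \<kappa>') \<longrightarrow> Z x = x)"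

text \<open>\<open>elementary_movement N Z c\<close>: some choice of arrays and swapping couples describes \<open>Z\<close> and has
  cost \<open>c\<close>. The cost belongs to the description, so one \<open>Z\<close> may have several costs.\<close>

definition elementary_movement :: "nat \<Rightarrow> (real ^ 'n \<Rightarrow> real ^ 'n) \<Rightarrow> real \<Rightarrow> bool" where
  "elementary_movement N Z c \<longleftrightarrow>
     (\<exists>(m :: nat) A \<kappa> h p.
        1 \<le> m \<and>
        (\<forall>i\<in>{1..m}. A i \<in> arrays N \<and> consecutive_cubes N (A i) (\<kappa> i) \<and>
           swapping_indices (array_length N (A i)) (h i) (p i)) \<and>
        (\<forall>i\<in>{1..m}. \<forall>i'\<in>{1..m}. i \<noteq> i' \<longrightarrow> interior (A i) \<inter> interior (A i') = {}) \<and>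
        exchanges Z (\<Union>i\<in>{1..m}. swapping_couples (\<kappa> i) (h i) (p i)) \<and>
        c = real (Max ((\<lambda>i. array_length N (A i)) ` {1..m})) *
            real N powr (- 1 - real CARD('n) / 2) * sqrt (real (\<Sum>i=1..m. h i)))"

text \<open>A discrete flow \<open>[(Z\<^sub>1, c\<^sub>1), \<dots>, (Z\<^sub>T, c\<^sub>T)]\<close> carries the costs of its movements.\<close>

definition discrete_flow :: "nat \<Rightarrow> ((real ^ 'n \<Rightarrow> real ^ 'n) \<times> real) list \<Rightarrow> bool" where
  "discrete_flow N F \<longleftrightarrow> (\<forall>(Z, c)\<in>set F. elementary_movement N Z c)"

definition flow_length :: "((real ^ 'n \<Rightarrow> real ^ 'n) \<times> real) list \<Rightarrow> real" where
  "flow_length F = (\<Sum>(Z, c)\<leftarrow>F. c)"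

definition flow_connects ::
    "((real ^ 'n \<Rightarrow> real ^ 'n) \<times> real) list \<Rightarrow> (real ^ 'n \<Rightarrow> real ^ 'n) \<Rightarrow> (real ^ 'n \<Rightarrow> real ^ 'n) \<Rightarrow> bool"
  where
  "flow_connects F P Q \<longleftrightarrow>
     (AE x in lebesgue_on unit_cube. fold (\<lambda>(Z, c) f. Z \<circ> f) F P x = Q x)"

text \<open>The infimum is a minimum, see \<open>perm_dist_attained\<close>. It is taken in \<^typ>\<open>ereal\<close>, so that the
  distance would be infinite if no flow existed. The empty flow gives distance \<open>0\<close> if \<open>P = Q\<close>.\<close>

definition perm_dist :: "nat \<Rightarrow> (real ^ 'n \<Rightarrow> real ^ 'n) \<Rightarrow> (real ^ 'n \<Rightarrow> real ^ 'n) \<Rightarrow> ereal" where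
  "perm_dist N P Q = (INF F \<in> {F. discrete_flow N F \<and> flow_connects F P Q}. ereal (flow_length F))"

lemma finite_low_sums:
  fixes G :: "real set"
  assumes nonneg: "\<And>c. c \<in> G \<Longrightarrow> 0 \<le> c" and fin: "\<And>b. finite {c \<in> G. c \<le> b}"
  shows "finite {sum_list cs | cs. set cs \<subseteq> G \<and> sum_list cs \<le> b}"
proof -
  define G' where "G' = {c \<in> G. c \<le> b \<and> 0 < c}"
  have finG': "finite G'"
    by (rule finite_subset[OF _ fin[of b]]) (auto simp: G'_def)
  obtain e where e: "e > 0" "\<And>c. c \<in> G' \<Longrightarrow> e \<le> c"
  proof (cases "G' = {}")
    case False
    show ?thesis
      by (rule that[of "Min G'"]) (use finG' False in \<open>auto simp: G'_def\<close>)
  qed (use that[of 1] in auto)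
  define k where "k = nat \<lceil>b / e\<rceil>"
  have "sum_list cs \<in> sum_list ` {ds. set ds \<subseteq> G' \<and> length ds \<le> k}"
    if cs: "set cs \<subseteq> G" "sum_list cs \<le> b" for cs
  proof -
    define ds where "ds = filter (\<lambda>c. 0 < c) cs"
    have sum_eq: "sum_list ds = sum_list cs"
    proof -
      have "sum_list (filter (\<lambda>c. 0 < c) xs) = sum_list xs" if "set xs \<subseteq> G" for xs
        using that
      proof (induction xs)
        case (Cons a xs)
        then show ?case using nonneg[of a] by auto
      qed simp
      then show ?thesis using cs unfolding ds_def by blast
    qed
    have "c \<le> sum_list xs \<and> 0 \<le> sum_list xs" if "set xs \<subseteq> G" "c \<in> insert 0 (set xs)" for xs c
      using that
    proof (induction xs arbitrary: c)
      case (Cons a xs)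
      have "0 \<le> a" using Cons.prems nonneg by auto
      moreover have "0 \<le> sum_list xs" using Cons.IH[of 0] Cons.prems by auto
      moreover have "c \<le> sum_list xs" if "c \<in> set xs" using Cons.IH[of c] Cons.prems that by auto
      ultimately show ?case using Cons.prems by auto
    qed auto
    then have "c \<le> b" if "c \<in> set cs" for c
      using cs that by (meson insertI2 order_trans)
    then have sub: "set ds \<subseteq> G'"
      using cs unfolding ds_def G'_def by auto
    have "e * real (length xs) \<le> sum_list xs" if "set xs \<subseteq> G'" for xs
      using that
    proof (induction xs)
      case (Cons a xs)
      then show ?case using e(2)[of a] by (auto simp: algebra_simps)
    qed simp
    from this[OF sub] have "e * real (length ds) \<le> b" using sum_eq cs by simp
    then have "real (length ds) \<le> b / e" using e(1) by (simp add: field_simps)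
    then have "length ds \<le> k" unfolding k_def by linarith
    then show ?thesis using sub by (intro image_eqI[of _ _ ds]) (auto simp: sum_eq)
  qed
  then have "{sum_list cs | cs. set cs \<subseteq> G \<and> sum_list cs \<le> b}
      \<subseteq> sum_list ` {ds. set ds \<subseteq> G' \<and> length ds \<le> k}" by blast
  then show ?thesis
    using finite_lists_length_le[OF finG', of k] finite_subset by blast
qed

lemma elementary_movement_cost_form:
  fixes Z :: "real ^ 'n \<Rightarrow> real ^ 'n"
  assumes "elementary_movement N Z c"
  shows "\<exists>a b :: nat. c = real a * real N powr (- 1 - real CARD('n) / 2) * sqrt (real b)"
  using assms unfolding elementary_movement_def by (elim exE conjE) (intro exI, assumption)

lemma finite_low_costs:
  "finite {c \<in> Collect (\<lambda>c. \<exists>Z :: real ^ 'n \<Rightarrow> real ^ 'n. elementary_movement N Z c). c \<le> b}"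
proof -
  define w where "w = real N powr (- 1 - real CARD('n) / 2)"
  have "w \<ge> 0" by (simp add: w_def)
  define k where "k = nat \<lceil>b / w\<rceil>"
  define l where "l = nat \<lceil>(b / w)\<^sup>2\<rceil>"
  define W where "W = insert 0 ((\<lambda>(x, y). real x * w * sqrt (real y)) ` ({..k} \<times> {..l}))"
  have "c \<in> W"
    if mv: "elementary_movement N (Z :: real ^ 'n \<Rightarrow> real ^ 'n) c" and cb: "c \<le> b" for Z c
  proof -
    obtain x y :: nat where c: "c = real x * w * sqrt (real y)"
      using elementary_movement_cost_form[OF mv] unfolding w_def by blast
    show ?thesis
    proof (cases "c = 0")
      case False
      then have "w \<noteq> 0" "x \<noteq> 0" "y \<noteq> 0" using c by auto
      then have "w > 0" and xy: "x \<ge> 1" "y \<ge> 1" using \<open>w \<ge> 0\<close> by auto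
      then have le: "real x * sqrt (real y) \<le> b / w"
        using cb c by (simp add: field_simps)
      have "real x * 1 \<le> real x * sqrt (real y)"
        by (rule mult_left_mono) (use xy in auto)
      then have "real x \<le> b / w" using le by simp
      then have x: "x \<le> k" unfolding k_def by linarith
      have "1 * sqrt (real y) \<le> real x * sqrt (real y)"
        by (rule mult_right_mono) (use xy in auto)
      then have "sqrt (real y) \<le> b / w" using le by simp
      then have "(sqrt (real y))\<^sup>2 \<le> (b / w)\<^sup>2"
        by (rule power_mono) simp
      then have "real y \<le> (b / w)\<^sup>2" by simp
      then have "y \<le> l" unfolding l_def by linarith
      with x show ?thesis unfolding c W_def by (intro insertI2 image_eqI[of _ _ "(x, y)"]) auto
    qed (simp add: W_def)
  qed
  then have "{c \<in> Collect (\<lambda>c. \<exists>Z :: real ^ 'n \<Rightarrow> real ^ 'n. elementary_movement N Z c). c \<le> b} \<subseteq> W"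
    by blast
  moreover have "finite W" by (simp add: W_def)
  ultimately show ?thesis by (rule finite_subset)
qed

lemma perm_dist_attained:
  fixes P Q :: "real ^ 'n \<Rightarrow> real ^ 'n"
  assumes "\<exists>F. discrete_flow N F \<and> flow_connects F P Q"
  shows "\<exists>F. discrete_flow N F \<and> flow_connects F P Q \<and> perm_dist N P Q = ereal (flow_length F) \<and>
           (\<forall>F'. discrete_flow N F' \<and> flow_connects F' P Q \<longrightarrow> flow_length F \<le> flow_length F')"
proof -
  define G where "G = Collect (\<lambda>c. \<exists>Z :: real ^ 'n \<Rightarrow> real ^ 'n. elementary_movement N Z c)"
  define L where "L = flow_length ` {F. discrete_flow N F \<and> flow_connects F P Q}"
  obtain F0 where F0: "discrete_flow N F0" "flow_connects F0 P Q" using assms by blast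
  define low where "low = {l \<in> L. l \<le> flow_length F0}"
  have nonneg: "0 \<le> c" if "c \<in> G" for c
  proof -
    from that obtain Z :: "real ^ 'n \<Rightarrow> real ^ 'n" where "elementary_movement N Z c"
      unfolding G_def by blast
    from elementary_movement_cost_form[OF this] show ?thesis by auto
  qed
  have fin: "finite {c \<in> G. c \<le> b}" for b
    unfolding G_def by (rule finite_low_costs)
  have "low \<subseteq> {sum_list cs | cs. set cs \<subseteq> G \<and> sum_list cs \<le> flow_length F0}"
  proof
    fix l assume "l \<in> low"
    then obtain F :: "((real ^ 'n \<Rightarrow> real ^ 'n) \<times> real) list"
      where F: "discrete_flow N F" "l = flow_length F" "l \<le> flow_length F0"
      unfolding low_def L_def image_iff by blast
    have "l = sum_list (map snd F)"
      using F(2) by (simp add: flow_length_def case_prod_unfold)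
    moreover have "set (map snd F) \<subseteq> G"
      using F(1) unfolding discrete_flow_def G_def by fastforce
    ultimately show "l \<in> {sum_list cs | cs. set cs \<subseteq> G \<and> sum_list cs \<le> flow_length F0}"
      using F(3) by blast
  qed
  then have finlow: "finite low"
    using finite_low_sums[OF nonneg fin] finite_subset by blast
  have F0low: "flow_length F0 \<in> low" using F0 unfolding low_def L_def by blast
  have "Min low \<in> low" using finlow F0low Min_in by blast
  then have "Min low \<in> L" by (simp add: low_def)
  then obtain F where F: "discrete_flow N F" "flow_connects F P Q" "flow_length F = Min low"
    unfolding L_def by force
  have min: "flow_length F \<le> l" if "l \<in> L" for l
  proof (cases "l \<le> flow_length F0")
    case True
    then show ?thesis using F(3) that finlow Min_le unfolding low_def by auto
  next
    case False
    then show ?thesis using Min_le[OF finlow F0low] F(3) by linarith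
  qed
  have "perm_dist N P Q = ereal (flow_length F)"
    unfolding perm_dist_def
    by (rule antisym[OF INF_lower INF_greatest]) (use F min in \<open>auto simp: L_def\<close>)
  moreover have "flow_length F \<le> flow_length F'"
    if "discrete_flow N F'" "flow_connects F' P Q" for F'
    using min that unfolding L_def by blast
  ultimately show ?thesis using F(1,2) by metis
qed

end

theory Submission
  imports Defs
begin

text \<open>
  The flow is a Benes network whose switches are reflections. Reflecting one coordinate within
  blocks of length \<open>2 ^ (j + 1)\<close> swaps the two halves of each block, and swapping any subset of the
  mirror pairs is one elementary movement along arrays of length \<open>2 ^ (j + 1)\<close>, because mirror pairs
  are nested couples. Given a permutation \<open>\<pi>\<close> and such a reflection \<open>\<sigma>\<close>, the two involutions \<open>\<sigma>\<close> and
  \<open>\<pi>\<inverse> \<sigma> \<pi>\<close> have a common proper 2-colouring, which tells which pairs to swap before and after \<open>\<pi>\<close> so that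
  the conjugated permutation no longer moves cells across the halves. Each coordinate and scale is
  treated once and costs at most \<open>2 * 2 ^ (j + 1) / N\<close>, since the number of couples is at most the
  number \<open>N ^ \<nu>\<close> of cells. Starting from blocks of side \<open>2 ^ m = \<delta> powr \<epsilon> * N\<close>, the geometric series
  over the scales sums to at most \<open>4 * \<nu> * \<delta> powr \<epsilon>\<close>.
\<close>

subsection \<open>Common colourings of two involutions\<close>

definition fpf_involution_on :: "'a set \<Rightarrow> ('a \<Rightarrow> 'a) \<Rightarrow> bool" where
  "fpf_involution_on X \<sigma> \<longleftrightarrow> (\<forall>x\<in>X. \<sigma> x \<in> X \<and> \<sigma> x \<noteq> x \<and> \<sigma> (\<sigma> x) = x)"

text \<open>Joining each \<open>x\<close> to \<open>\<sigma> x\<close> and \<open>\<tau> x\<close>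
  yields disjoint cycles that alternate between the two kinds of edge; they have even length and are
  therefore 2-colourable. The induction never names the cycles: it removes two points of one cycle
  at a time.\<close>

lemma common_two_colouring:
  assumes "finite X" "fpf_involution_on X \<sigma>" "fpf_involution_on X \<tau>"
  shows "\<exists>c. \<forall>x\<in>X. c (\<sigma> x) = (\<not> c x) \<and> c (\<tau> x) = (\<not> c x)"
  using assms
proof (induction "card X" arbitrary: X \<tau> rule: less_induct)
  case less
  note \<sigma> = less.prems(2)[unfolded fpf_involution_on_def, rule_format]
  note \<tau> = less.prems(3)[unfolded fpf_involution_on_def, rule_format]
  show ?case
  proof (cases "X = {}")
    case False
    then obtain a where a: "a \<in> X" by blast
    define b where "b = \<sigma> a"
    have b: "b \<in> X" "b \<noteq> a" "\<sigma> b = a" using \<sigma>[OF a] by (auto simp: b_def)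
    define u where "u = \<tau> a"
    define v where "v = \<tau> b"
    have u: "u \<in> X" "u \<noteq> a" "\<tau> u = a" using \<tau>[OF a] by (auto simp: u_def)
    have v: "v \<in> X" "v \<noteq> b" "\<tau> v = b" using \<tau>[OF b(1)] by (auto simp: v_def)
    have uv: "u = b \<longleftrightarrow> v = a" using \<tau> a b unfolding u_def v_def by metis
    have neq: "u \<noteq> v" using u v b by metis
    \<comment> \<open>Remove the \<open>\<sigma>\<close>-pair \<open>{a, b}\<close> and let \<open>\<tau>\<close> join the two orphaned partners \<open>u\<close> and \<open>v\<close>, which
      therefore get different colours.\<close>
    define Y where "Y = X - {a, b}"
    define \<tau>' where "\<tau>' = (\<lambda>x. if x = u then v else if x = v then u else \<tau> x)"
    have "card Y < card X"
      unfolding Y_def by (rule psubset_card_mono) (use less.prems(1) a in auto)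
    moreover have "finite Y" using less.prems(1) by (simp add: Y_def)
    moreover have "fpf_involution_on Y \<sigma>"
      unfolding fpf_involution_on_def
    proof
      fix x assume "x \<in> Y"
      then have x: "x \<in> X" "x \<noteq> a" "x \<noteq> b" by (auto simp: Y_def)
      have "\<sigma> x \<noteq> a" "\<sigma> x \<noteq> b" using \<sigma>[OF x(1)] x b by (metis b_def)+
      with \<sigma>[OF x(1)] show "\<sigma> x \<in> Y \<and> \<sigma> x \<noteq> x \<and> \<sigma> (\<sigma> x) = x"
        by (simp add: Y_def)
    qed
    moreover have "fpf_involution_on Y \<tau>'"
      unfolding fpf_involution_on_def
    proof
      fix x assume "x \<in> Y"
      then have x: "x \<in> X" "x \<noteq> a" "x \<noteq> b" by (auto simp: Y_def)
      consider "x = u" | "x = v" | "x \<noteq> u" "x \<noteq> v" by blast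
      then show "\<tau>' x \<in> Y \<and> \<tau>' x \<noteq> x \<and> \<tau>' (\<tau>' x) = x"
      proof cases
        case 1
        then show ?thesis using x neq uv v by (auto simp: \<tau>'_def Y_def)
      next
        case 2
        then show ?thesis using x neq uv u by (auto simp: \<tau>'_def Y_def)
      next
        case 3
        have "\<tau> x \<noteq> a" "\<tau> x \<noteq> b" "\<tau> x \<noteq> u" "\<tau> x \<noteq> v"
          using \<tau>[OF x(1)] 3 x u v by (metis u_def v_def)+
        then show ?thesis using \<tau>[OF x(1)] 3 by (simp add: \<tau>'_def Y_def)
      qed
    qed
    ultimately obtain c where c: "c (\<sigma> x) = (\<not> c x)" "c (\<tau>' x) = (\<not> c x)" if "x \<in> Y" for x
      using less.hyps[of Y \<tau>'] by blast
    \<comment> \<open>Each of \<open>a\<close> and \<open>b\<close> gets the colour opposite to its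
      \<open>\<tau>\<close>-partner. These colours differ because \<open>\<tau>'\<close> forces
      \<open>u\<close> and \<open>v\<close> apart. If \<open>u = b\<close>, then
      \<open>{a, b}\<close> is a whole cycle and \<open>c u\<close> is just some value fixing which
      of the two is coloured true.\<close>
    define c' where "c' = (\<lambda>x. if x = a then \<not> c u else if x = b then c u else c x)"
    have "c' (\<sigma> x) = (\<not> c' x) \<and> c' (\<tau> x) = (\<not> c' x)" if x: "x \<in> X" for x
    proof -
      have cuv: "c v = (\<not> c u)" if "u \<noteq> b"
        using c(2)[of u] that u uv neq by (auto simp: Y_def \<tau>'_def)
      consider "x = a" | "x = b" | "x \<in> Y" using x by (auto simp: Y_def)
      then show ?thesis
      proof cases
        case 1
        then show ?thesis using b u by (auto simp: c'_def b_def[symmetric] u_def[symmetric])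
      next
        case 2
        then show ?thesis using b v uv cuv by (auto simp: c'_def v_def[symmetric])
      next
        case 3
        then have x: "x \<in> X" "x \<noteq> a" "x \<noteq> b" by (auto simp: Y_def)
        have "\<sigma> x \<noteq> a" "\<sigma> x \<noteq> b" using \<sigma>[OF x(1)] x b by (metis b_def)+
        then have 1: "c' (\<sigma> x) = (\<not> c' x)" using c(1)[OF 3] x by (simp add: c'_def)
        consider "x = u" | "x = v" | "x \<noteq> u" "x \<noteq> v" by blast
        then have "c' (\<tau> x) = (\<not> c' x)"
        proof cases
          case 1
          then show ?thesis using x u by (simp add: c'_def)
        next
          case 2
          then show ?thesis using x v uv cuv b by (auto simp: c'_def)
        next
          case nuv: 3
          have "\<tau> x \<noteq> a" "\<tau> x \<noteq> b" using \<tau>[OF x(1)] nuv x by (metis u_def v_def)+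
          then show ?thesis using c(2)[OF 3] nuv x by (simp add: c'_def \<tau>'_def)
        qed
        with 1 show ?thesis by blast
      qed
    qed
    then show ?thesis by blast
  qed simp
qed

section \<open>Swapping selected pairs, and one step of the Benes network\<close>

definition swap_on :: "'a set \<Rightarrow> ('a \<Rightarrow> 'a) \<Rightarrow> 'a \<Rightarrow> 'a" where
  "swap_on T \<sigma> x = (if x \<in> T then \<sigma> x else x)"

text \<open>For an involution this says that \<open>T\<close> is a union of
  \<open>\<sigma>\<close>-pairs, so that \<open>swap_on T \<sigma>\<close> exchanges whole pairs and
  is an involution itself.\<close>

definition closed_under :: "('a \<Rightarrow> 'a) \<Rightarrow> 'a set \<Rightarrow> bool" where
  "closed_under \<sigma> T \<longleftrightarrow> \<sigma> ` T \<subseteq> T"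

lemma swap_on_swap_on:
  assumes "fpf_involution_on X \<sigma>" "T \<subseteq> X" "closed_under \<sigma> T"
  shows "swap_on T \<sigma> (swap_on T \<sigma> x) = x"
  using assms by (auto simp: swap_on_def fpf_involution_on_def closed_under_def)

lemma swap_on_in:
  assumes "fpf_involution_on X \<sigma>" "x \<in> X"
  shows "swap_on T \<sigma> x \<in> X"
  using assms by (auto simp: swap_on_def fpf_involution_on_def)

lemma bij_betw_swap_on:
  assumes "fpf_involution_on X \<sigma>" "T \<subseteq> X" "closed_under \<sigma> T"
  shows "bij_betw (swap_on T \<sigma>) X X"
  by (rule bij_betw_byWitness[of _ "swap_on T \<sigma>"])
    (use swap_on_swap_on[OF assms] swap_on_in[OF assms(1)] in auto)

text \<open>\<open>s\<close> tells the two halves exchanged by \<open>\<sigma>\<close> apart; \<open>T\<close> and \<open>U\<close> are the sets where the common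
  colouring of \<open>\<sigma>\<close> and \<open>\<pi>\<inverse> \<sigma> \<pi>\<close>, read before and after \<open>\<pi>\<close>, disagrees with \<open>s\<close>.\<close>

lemma benes_step:
  assumes fin: "finite X" and \<sigma>: "fpf_involution_on X \<sigma>" and \<pi>: "bij_betw \<pi> X X"
    and s: "\<And>x. x \<in> X \<Longrightarrow> s (\<sigma> x) = (\<not> s x)"
  obtains T U where "T \<subseteq> X" "closed_under \<sigma> T" "U \<subseteq> X" "closed_under \<sigma> U"
    "\<And>x. x \<in> X \<Longrightarrow> s (swap_on U \<sigma> (\<pi> (swap_on T \<sigma> x))) = s x"
proof -
  define \<rho> where "\<rho> = the_inv_into X \<pi>"
  have \<rho>: "\<rho> y \<in> X" "\<pi> (\<rho> y) = y" if "y \<in> X" for y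
    using that \<pi> unfolding \<rho>_def
    by (auto simp: bij_betw_def f_the_inv_into_f intro: the_inv_into_into)
  have \<rho>\<pi>: "\<rho> (\<pi> x) = x" "\<pi> x \<in> X" if "x \<in> X" for x
    using that \<pi> unfolding \<rho>_def by (auto simp: bij_betw_def the_inv_into_f_f)
  have inv: "\<sigma> x \<in> X" "\<sigma> x \<noteq> x" "\<sigma> (\<sigma> x) = x" if "x \<in> X" for x
    using \<sigma> that by (auto simp: fpf_involution_on_def)
  \<comment> \<open>The conjugate pairs those inputs whose \<open>\<pi>\<close>-images are
    \<open>\<sigma>\<close>-partners, so one colouring serves both sides of
    \<open>\<pi>\<close>.\<close>
  have "fpf_involution_on X (\<lambda>x. \<rho> (\<sigma> (\<pi> x)))"
    unfolding fpf_involution_on_def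
  proof
    fix x assume x: "x \<in> X"
    have "\<rho> (\<sigma> (\<pi> x)) \<noteq> x"
      using inv[of "\<pi> x"] \<rho>\<pi>[OF x] \<rho>(2)[of "\<sigma> (\<pi> x)"] by metis
    then show "\<rho> (\<sigma> (\<pi> x)) \<in> X \<and> \<rho> (\<sigma> (\<pi> x)) \<noteq> x \<and> \<rho> (\<sigma> (\<pi> (\<rho> (\<sigma> (\<pi> x))))) = x"
      using x by (simp add: \<rho> \<rho>\<pi> inv)
  qed
  from common_two_colouring[OF fin \<sigma> this] obtain c
    where c: "\<And>x. x \<in> X \<Longrightarrow> c (\<sigma> x) = (\<not> c x)"
      and c\<pi>: "\<And>x. x \<in> X \<Longrightarrow> c (\<rho> (\<sigma> (\<pi> x))) = (\<not> c x)" by blast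
  define T where "T = {x \<in> X. c x \<noteq> s x}"
  define U where "U = {y \<in> X. c (\<rho> y) \<noteq> s y}"
  have c\<rho>: "c (\<rho> (\<sigma> y)) = (\<not> c (\<rho> y))" if "y \<in> X" for y
    using c\<pi>[of "\<rho> y"] \<rho>[OF that] by simp
  show ?thesis
  proof
    show "T \<subseteq> X" "U \<subseteq> X" by (auto simp: T_def U_def)
    show "closed_under \<sigma> T" using c s inv by (auto simp: T_def closed_under_def)
    show "closed_under \<sigma> U" using c\<rho> s inv by (auto simp: U_def closed_under_def)
    fix x assume x: "x \<in> X"
    \<comment> \<open>The first swap turns the side \<open>s\<close> into the colour
      \<open>c\<close>, \<open>\<pi>\<close> transports the colour, and the second swap turns it
      back into a side.\<close>
    have "c (swap_on T \<sigma> x) = s x"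
      using x c by (auto simp: T_def swap_on_def)
    moreover have "s (swap_on U \<sigma> y) = c (\<rho> y)" if "y \<in> X" for y
      using that s by (auto simp: U_def swap_on_def)
    moreover have "swap_on T \<sigma> x \<in> X" using swap_on_in[OF \<sigma> x] .
    ultimately show "s (swap_on U \<sigma> (\<pi> (swap_on T \<sigma> x))) = s x"
      using \<rho>\<pi> by simp
  qed
qed

subsection \<open>Cells of the grid\<close>

definition indices :: "nat \<Rightarrow> ('n \<Rightarrow> nat) set" where
  "indices N = {x. \<forall>i. x i < N}"

definition cell :: "nat \<Rightarrow> ('n::finite \<Rightarrow> nat) \<Rightarrow> (real ^ 'n) set" where
  "cell N x = grid_box N x (\<lambda>i. x i + 1)"

text \<open>On interiors of cells this inverts \<open>cell N\<close>. On a face between two cells it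
  picks the upper one, and at coordinate 1 it gives \<open>N\<close>, outside
  \<open>indices N\<close>.\<close>

definition locate :: "nat \<Rightarrow> real ^ 'n \<Rightarrow> 'n \<Rightarrow> nat" where
  "locate N p = (\<lambda>i. nat \<lfloor>real N * p $ i\<rfloor>)"

lemma tiling_eq: "tiling N = cell N ` indices N"
  by (auto simp: tiling_def cell_def indices_def)

lemma finite_indices: "finite (indices N :: ('n::finite \<Rightarrow> nat) set)"
proof -
  have "indices N = PiE UNIV (\<lambda>_::'n. {..<N})" by (auto simp: indices_def PiE_def)
  then show ?thesis by (simp add: finite_PiE)
qed

lemma card_indices: "card (indices N :: ('n::finite \<Rightarrow> nat) set) = N ^ CARD('n)"
proof -
  have "indices N = PiE UNIV (\<lambda>_::'n. {..<N})" by (auto simp: indices_def PiE_def)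
  then show ?thesis by (simp add: card_PiE)
qed

lemma locate_interior_grid_box:
  assumes "0 < N" "p \<in> interior (grid_box N h h')"
  shows "h i \<le> locate N p i \<and> locate N p i < h' i"
proof -
  have "real (h i) / real N < p $ i" "p $ i < real (h' i) / real N"
    using assms(2) by (auto simp: grid_box_def mem_box_cart)
  then have "real (h i) < real N * p $ i" "real N * p $ i < real (h' i)"
    using assms(1) by (simp_all add: field_simps)
  then show ?thesis unfolding locate_def by linarith
qed

lemma locate_interior_cell:
  assumes "0 < N" "p \<in> interior (cell N x)"
  shows "locate N p = x"
  using locate_interior_grid_box[OF assms(1) assms(2)[unfolded cell_def]]
  by (intro ext le_antisym) (auto simp: less_Suc_eq_le)

lemma grid_box_subset_iff:
  assumes "0 < N" "\<And>i. h i < h' i"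
  shows "grid_box N h h' \<subseteq> grid_box N k k' \<longleftrightarrow> (\<forall>i. k i \<le> h i \<and> h' i \<le> k' i)"
proof -
  have "real (h i) / real N \<le> real (h' i) / real N" for i
    using assms by (simp add: divide_right_mono less_imp_le)
  then show ?thesis
    using assms(1)
    unfolding grid_box_def subset_interval_cart(1) by (simp add: divide_le_cancel)
qed

lemma cell_subset_iff:
  assumes "0 < N"
  shows "cell N x \<subseteq> grid_box N k k' \<longleftrightarrow> (\<forall>i. k i \<le> x i \<and> x i < k' i)"
  unfolding cell_def by (subst grid_box_subset_iff) (use assms in \<open>auto simp: Suc_le_eq\<close>)

lemma cell_eq_iff:
  assumes "0 < N"
  shows "cell N x = cell N y \<longleftrightarrow> x = y"
proof
  assume "cell N x = cell N y"
  then have "cell N x \<subseteq> grid_box N y (\<lambda>i. y i + 1)" by (simp only: cell_def)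
  then have "\<forall>i. y i \<le> x i \<and> x i < y i + 1" unfolding cell_subset_iff[OF assms] .
  then show "x = y" by (intro ext le_antisym) (auto simp: less_Suc_eq_le)
qed simp

lemma inj_on_cell: "0 < N \<Longrightarrow> inj_on (cell N) X"
  by (simp add: inj_on_def cell_eq_iff)

lemma center_cell:
  assumes "0 < N"
  shows "center (cell N x) = (\<chi> i. (real (x i) + 1 / 2) / real N)"
proof -
  have "cell N x = cbox (\<chi> i. real (x i) / real N) (\<chi> i. (real (x i) + 1) / real N)"
    by (simp add: cell_def grid_box_def add.commute)
  \<comment> \<open>The box must be nonempty for its interval bounds to be its corners.\<close>
  moreover have "\<forall>i\<in>Basis. (\<chi> i. real (x i) / real N) \<bullet> i \<le> (\<chi> i. (real (x i) + 1) / real N) \<bullet> i"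
    by (auto simp: Basis_vec_def inner_axis divide_right_mono)
  ultimately show ?thesis
    using assms by (simp add: center_def midpoint_def vec_eq_iff field_simps)
qed

lemma interior_cell_iff:
  assumes "0 < N"
  shows "p \<in> interior (cell N x) \<longleftrightarrow> (\<forall>i. real (x i) < real N * p $ i \<and> real N * p $ i < real (x i) + 1)"
proof -
  have "real (x i) / real N < p $ i \<longleftrightarrow> real (x i) < real N * p $ i"
    "p $ i < real (x i + 1) / real N \<longleftrightarrow> real N * p $ i < real (x i) + 1" for i
    using assms by (simp_all add: pos_divide_less_eq pos_less_divide_eq mult.commute add.commute)
  then show ?thesis by (simp add: cell_def grid_box_def mem_box_cart del: of_nat_add)
qed

lemma interior_cell_translate:
  assumes "0 < N" "p \<in> interior (cell N x)"
  shows "p + center (cell N y) - center (cell N x) \<in> interior (cell N y)"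
proof -
  have N: "real N \<noteq> 0" using assms(1) by simp
  have eq: "real N * (p + center (cell N y) - center (cell N x)) $ i
      = real N * p $ i + real (y i) - real (x i)" for i
  proof -
    have "real N * center (cell N z) $ i = real (z i) + 1 / 2" for z
      unfolding center_cell[OF assms(1)] using N by simp
    then show ?thesis
      by (simp add: right_diff_distrib distrib_left)
  qed
  have x: "real (x i) < real N * p $ i" "real N * p $ i < real (x i) + 1" for i
    using assms(2) unfolding interior_cell_iff[OF assms(1)] by blast+
  show ?thesis
    unfolding interior_cell_iff[OF assms(1)] eq
  proof (intro allI conjI)
    fix i
    show "real (y i) < real N * p $ i + real (y i) - real (x i)" using x(1)[of i] by linarith
    show "real N * p $ i + real (y i) - real (x i) < real (y i) + 1" using x(2)[of i] by linarith
  qed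
qed

section \<open>Maps that translate cells, as maps of indices\<close>

definition acts_by :: "nat \<Rightarrow> (real ^ 'n \<Rightarrow> real ^ 'n) \<Rightarrow> (('n::finite \<Rightarrow> nat) \<Rightarrow> 'n \<Rightarrow> nat) \<Rightarrow> bool" where
  "acts_by N f \<pi> \<longleftrightarrow> (\<forall>x\<in>indices N. \<forall>p\<in>interior (cell N x).
     f p = p + center (cell N (\<pi> x)) - center (cell N x))"

text \<open>\<open>acts_by\<close> records a map up to the cell boundaries. A translation carries
  the interior of a cell onto the interior of its target, where the second formula applies, so
  composition of maps becomes composition of index maps.\<close>

lemma acts_by_comp:
  assumes "0 < N" "acts_by N f \<pi>" "acts_by N g \<rho>" "\<pi> \<in> indices N \<rightarrow> indices N"
  shows "acts_by N (g \<circ> f) (\<rho> \<circ> \<pi>)"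
  unfolding acts_by_def
proof (intro ballI)
  fix x :: "'a \<Rightarrow> nat" and p :: "real ^ 'a"
  assume x: "x \<in> indices N" and p: "p \<in> interior (cell N x)"
  have "f p = p + center (cell N (\<pi> x)) - center (cell N x)"
    using assms(2) x p by (auto simp: acts_by_def)
  moreover from this have "f p \<in> interior (cell N (\<pi> x))"
    using interior_cell_translate[OF assms(1) p] by simp
  moreover have "\<pi> x \<in> indices N" using assms(4) x by auto
  ultimately show "(g \<circ> f) p = p + center (cell N ((\<rho> \<circ> \<pi>) x)) - center (cell N x)"
    using assms(3) by (auto simp: acts_by_def)
qed

lemma acts_by_cong:
  assumes "acts_by N f \<pi>" "\<And>x. x \<in> indices N \<Longrightarrow> \<pi> x = \<rho> x"
  shows "acts_by N f \<rho>"
  using assms by (auto simp: acts_by_def)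

lemma unit_cube_subset_cells:
  assumes "0 < N"
  shows "unit_cube \<subseteq> (\<Union>x\<in>(indices N :: ('n::finite \<Rightarrow> nat) set). cell N x)"
proof
  fix p :: "real ^ 'n" assume "p \<in> unit_cube"
  then have p: "0 \<le> p $ i" "p $ i \<le> 1" for i by (auto simp: unit_cube_def mem_box_cart)
  \<comment> \<open>The cap at \<open>N - 1\<close> assigns the upper faces of the unit cube to the
    last layer of cells.\<close>
  define x where "x = (\<lambda>i. min (locate N p i) (N - 1))"
  have "x \<in> indices N" using assms by (auto simp: x_def indices_def)
  moreover have "real (x i) \<le> real N * p $ i \<and> real N * p $ i \<le> real (x i) + 1" for i
  proof -
    have "0 \<le> real N * p $ i" using p by simp
    moreover have "real N * p $ i \<le> real N" using p[of i] mult_left_le[of "p $ i" "real N"] by simp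
    ultimately have "real (locate N p i) \<le> real N * p $ i" "real N * p $ i \<le> real (locate N p i) + 1"
        "real N * p $ i \<le> real (N - 1) + 1"
      using assms unfolding locate_def by linarith+
    then show ?thesis unfolding x_def min_def by auto
  qed
  then have "p \<in> cell N x"
    using assms by (simp add: cell_def grid_box_def mem_box_cart field_simps)
  ultimately show "p \<in> (\<Union>x\<in>indices N. cell N x)" by blast
qed

text \<open>The exceptional points lie on the finitely many cell boundaries, each of which is
  negligible; inside a cell the translation vector is zero.\<close>

lemma acts_by_id_AE:
  fixes f :: "real ^ 'n::finite \<Rightarrow> real ^ 'n"
  assumes "0 < N" "acts_by N f id"
  shows "AE x in lebesgue_on unit_cube. f x = id x"
proof -
  define B :: "(real ^ 'n) set" where "B = (\<Union>x\<in>indices N. cell N x - interior (cell N x))"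
  have "negligible B"
    unfolding B_def
    by (rule negligible_Union) (auto simp: finite_indices cell_def grid_box_def negligible_frontier_interval)
  then have "B \<in> null_sets lebesgue" by (simp add: negligible_iff_null_sets)
  then have "AE x in lebesgue. x \<notin> B" by (rule AE_not_in)
  then have "AE x in lebesgue. x \<in> unit_cube \<longrightarrow> f x = id x"
  proof eventually_elim
    case (elim p)
    show ?case
    proof
      assume "p \<in> unit_cube"
      then obtain x where "x \<in> indices N" "p \<in> interior (cell N x)"
        using unit_cube_subset_cells[OF assms(1)] elim unfolding B_def by blast
      then show "f p = id p" using assms(2) by (auto simp: acts_by_def)
    qed
  qed
  then show ?thesis
    by (subst AE_restrict_space_iff) (auto simp: unit_cube_def)
qed

text \<open>\<open>\<pi>\<close> is \<open>image_cube P\<close> read through the bijection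
  \<open>cell N\<close> from indices to tiles. The third conclusion gives access to hypotheses on
  image cubes.\<close>

lemma cube_permutation_acts_by:
  fixes P :: "real ^ 'n::finite \<Rightarrow> real ^ 'n"
  assumes "0 < N" "P \<in> cube_permutations N"
  obtains \<pi> where "bij_betw \<pi> (indices N) (indices N)" "acts_by N P \<pi>"
    "\<And>x. x \<in> indices N \<Longrightarrow> image_cube P (cell N x) = cell N (\<pi> x)"
proof -
  define \<pi> where "\<pi> = the_inv_into (indices N) (cell N :: _ \<Rightarrow> (real ^ 'n) set) \<circ> image_cube P \<circ> cell N"
  have cell: "bij_betw (cell N) (indices N) (tiling N)"
    by (simp add: bij_betw_def inj_on_cell assms tiling_eq)
  have P: "bij_betw (image_cube P) (tiling N) (tiling N)"
    "\<And>\<kappa> x. \<kappa> \<in> tiling N \<Longrightarrow> x \<in> interior \<kappa> \<Longrightarrow> P x = x + center (image_cube P \<kappa>) - center \<kappa>"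
    using assms(2) by (auto simp: cube_permutations_def)
  have eq: "image_cube P (cell N x) = cell N (\<pi> x)" if "x \<in> indices N" for x
  proof -
    have "image_cube P (cell N x) \<in> cell N ` indices N"
      using that P(1) by (metis bij_betw_apply imageI tiling_eq)
    from f_the_inv_into_f[OF inj_on_cell[OF assms(1)] this] show ?thesis
      by (simp add: \<pi>_def)
  qed
  have "bij_betw \<pi> (indices N) (indices N)"
    unfolding \<pi>_def by (intro bij_betw_trans[OF cell] bij_betw_trans[OF P(1)] bij_betw_the_inv_into cell)
  moreover have "acts_by N P \<pi>"
    unfolding acts_by_def
  proof (intro ballI)
    fix x :: "'n \<Rightarrow> nat" and p :: "real ^ 'n"
    assume "x \<in> indices N" "p \<in> interior (cell N x)"
    then show "P p = p + center (cell N (\<pi> x)) - center (cell N x)"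
      using P(2)[of "cell N x" p] eq[of x] by (simp add: tiling_eq)
  qed
  ultimately show ?thesis using eq that by blast
qed

text \<open>Each side of a coarse cube holds \<open>q\<close> fine cells, and division by
  \<open>q\<close> in every coordinate names the coarse cube containing a fine one. Staying inside
  it therefore preserves all quotients.\<close>

lemma constant_on_tiling_div:
  fixes P :: "real ^ 'n::finite \<Rightarrow> real ^ 'n"
  assumes "N = M * q" "0 < N" "constant_on_tiling N M P" "x \<in> indices N"
    "image_cube P (cell N x) = cell N y"
  shows "y i div q = x i div q"
proof -
  have pos: "0 < M" "0 < q" using assms by auto
  define K :: "(real ^ 'n) set" where "K = cell M (\<lambda>i. x i div q)"
  have K: "K = grid_box N (\<lambda>i. q * (x i div q)) (\<lambda>i. q * (x i div q) + q)"
  proof -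
    have "real (x i div q) / real M = real (q * (x i div q)) / real N"
      "real (x i div q + 1) / real M = real (q * (x i div q) + q) / real N" for i
      using pos by (simp_all add: assms(1) field_simps)
    then show ?thesis by (simp only: K_def cell_def grid_box_def)
  qed
  have "(\<lambda>i. x i div q) \<in> indices M"
    using assms(1,4) pos by (auto simp: indices_def less_mult_imp_div_less)
  then have "K \<in> tiling M" by (auto simp: tiling_eq K_def)
  moreover have "cell N x \<in> tiling N" using assms(4) by (auto simp: tiling_eq)
  moreover have "cell N x \<subseteq> K"
    unfolding K cell_subset_iff[OF assms(2)] using pos
    by (metis add.commute dividend_less_times_div mult.commute times_div_less_eq_dividend)
  ultimately have "cell N y \<subseteq> K"
    using assms(3,5) unfolding constant_on_tiling_def by metis
  then have "q * (x i div q) \<le> y i" "y i < q * (x i div q) + q"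
    unfolding K cell_subset_iff[OF assms(2)] by auto
  then show ?thesis
    by (metis add.commute div_nat_eqI mult.commute mult_Suc)
qed

subsection \<open>Reflections within blocks\<close>

text \<open>The block of length \<open>l\<close> is kept and the remainder is mirrored. A shift by
  half a block would also exchange the halves, but its pairs would cross instead of being
  nested.\<close>

definition reflect :: "nat \<Rightarrow> 'n \<Rightarrow> ('n \<Rightarrow> nat) \<Rightarrow> 'n \<Rightarrow> nat" where
  "reflect l d x = x(d := l * (x d div l) + (l - 1 - x d mod l))"

lemma reflect_other: "i \<noteq> d \<Longrightarrow> reflect l d x i = x i"
  by (simp add: reflect_def)

lemma reflect_div_mod:
  assumes "0 < l"
  shows "reflect l d x d div l = x d div l" "reflect l d x d mod l = l - 1 - x d mod l"
  using assms by (simp_all add: reflect_def)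

lemma reflect_reflect:
  assumes "0 < l"
  shows "reflect l d (reflect l d x) = x"
proof -
  have "x d mod l \<le> l - 1" using assms mod_less_divisor[of l "x d"] by linarith
  then have "reflect l d (reflect l d x) d = x d"
    unfolding reflect_def[of l d "reflect l d x"] using assms by (simp add: reflect_div_mod)
  then show ?thesis
    by (intro ext) (metis reflect_other)
qed

text \<open>A fixed remainder \<open>r = l - 1 - r\<close> would make \<open>l\<close> odd, and
  \<open>l dvd N\<close> keeps every block inside the grid.\<close>

lemma fpf_involution_on_reflect:
  assumes "l = 2 * q" "0 < q" "l dvd N"
  shows "fpf_involution_on (indices N) (reflect l d)"
  unfolding fpf_involution_on_def
proof
  fix x :: "'a \<Rightarrow> nat" assume x: "x \<in> indices N"
  have l: "0 < l" using assms by simp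
  have lt: "x d mod l < l" using l by simp
  have "reflect l d x d < N"
  proof -
    obtain k where k: "N = k * l" using assms(3) by (metis dvd_div_mult_self)
    have "x d < k * l" using x k by (simp add: indices_def)
    then have "x d div l < k" by (rule less_mult_imp_div_less)
    then have "(x d div l + 1) * l \<le> k * l" by (intro mult_le_mono1) simp
    then have "l * (x d div l) + l \<le> N" by (simp add: k algebra_simps)
    then show ?thesis using l by (simp add: reflect_def)
  qed
  then have "reflect l d x \<in> indices N"
    using x by (auto simp: indices_def reflect_def)
  moreover have "reflect l d x \<noteq> x"
  proof
    assume "reflect l d x = x"
    then have "l - 1 - x d mod l = x d mod l" using reflect_div_mod(2)[OF l] by metis
    then have "2 * q = 2 * r + 1" if "r = x d mod l" for r
      using lt assms(1) that by linarith
    from this[OF refl] show False by (metis dvd_triv_left even_plus_one_iff)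
  qed
  ultimately show "reflect l d x \<in> indices N \<and> reflect l d x \<noteq> x \<and> reflect l d (reflect l d x) = x"
    by (simp add: reflect_reflect[OF l])
qed

text \<open>This provides the side predicate \<open>s\<close> of \<open>benes_step\<close>.\<close>

lemma lower_half_reflect:
  assumes "l = 2 * q" "0 < q"
  shows "(reflect l d x d mod l < q) = (\<not> x d mod l < q)"
proof -
  have l: "0 < l" using assms by simp
  have "x d mod l < l" using l by simp
  then show ?thesis unfolding reflect_div_mod(2)[OF l] using assms by linarith
qed

text \<open>Cell number \<open>r\<close> of the row in direction \<open>d\<close> starting at
  \<open>b\<close>, counted from 1 to agree with \<open>consecutive_cubes\<close>.\<close>

definition slice :: "'n \<Rightarrow> ('n \<Rightarrow> nat) \<Rightarrow> nat \<Rightarrow> 'n \<Rightarrow> nat" where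
  "slice d b r = b(d := b d + (r - 1))"

lemma slice_div_mod:
  assumes "l dvd b d" "r \<in> {1..l}"
  shows "slice d b r d div l = b d div l" "slice d b r d mod l = r - 1"
proof -
  obtain k where k: "b d = l * k" using assms by auto
  have "r - 1 < l" using assms by auto
  then show "slice d b r d div l = b d div l" "slice d b r d mod l = r - 1"
    by (simp_all add: slice_def k)
qed

lemma reflect_slice:
  assumes "l dvd b d" "r \<in> {1..l}"
  shows "reflect l d (slice d b r) = slice d b (l + 1 - r)"
proof -
  have "l * (b d div l) = b d" using assms by simp
  moreover have "l - 1 - (r - 1) = l + 1 - r - 1" using assms by auto
  ultimately have "reflect l d (slice d b r) d = slice d b (l + 1 - r) d"
    unfolding reflect_def using slice_div_mod[of l b d r, OF assms] by (simp add: slice_def)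
  moreover have "reflect l d (slice d b r) i = slice d b (l + 1 - r) i" if "i \<noteq> d" for i
    using that by (simp add: reflect_def slice_def)
  ultimately show ?thesis by (intro ext) metis
qed

text \<open>List \<open>Q\<close> increasingly, then the mirror images of its elements in reverse
  order. All of \<open>Q\<close> lies in the lower half and all mirrors in the upper half, so the
  whole list increases, and pairing it from both ends matches each position with its mirror.\<close>

lemma swapping_indices_symmetric:
  fixes Q :: "nat set"
  assumes "Q \<subseteq> {1..q}"
  obtains h p where "h \<le> q" "swapping_indices (2 * q) h p"
    "\<And>\<kappa>. swapping_couples \<kappa> h p = (\<lambda>r. (\<kappa> r, \<kappa> (2 * q + 1 - r))) ` Q"
proof -
  have "finite Q" using assms finite_subset by blast
  then obtain e where e: "bij_betw e {..<card Q} Q" "strict_mono_on {..<card Q} e"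
    using ex_bij_betw_strict_mono_card by blast
  define h where "h = card Q"
  have h: "h \<le> q" unfolding h_def using card_mono[OF _ assms] by simp
  have eQ: "e i \<in> Q" if "i < h" for i using e(1) that by (auto simp: h_def bij_betw_def)
  have e1: "1 \<le> e i \<and> e i \<le> q" if "i < h" for i using eQ[OF that] assms by auto
  have emono: "e i < e j" if "i < j" "j < h" for i j
    using e(2) that by (auto simp: strict_mono_on_def h_def)
  \<comment> \<open>\<open>e\<close> counts from 0 and \<open>p\<close> from 1: index
    \<open>j > h\<close> is nested with \<open>2 * h - j + 1\<close>, whose position is
    \<open>e (2 * h - j)\<close>.\<close>
  define p where "p j = (if j \<le> h then e (j - 1) else 2 * q + 1 - e (2 * h - j))" for j
  have "p i < p j" if "1 \<le> i" "i < j" "j \<le> 2 * h" for i j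
  proof -
    consider "j \<le> h" | "i \<le> h" "h < j" | "h < i" using that by linarith
    then show ?thesis
    proof cases
      case 1
      then show ?thesis using that emono[of "i - 1" "j - 1"] by (simp add: p_def)
    next
      case 2
      then have "e (i - 1) \<le> q" "e (2 * h - j) \<le> q"
        using e1[of "i - 1"] e1[of "2 * h - j"] that by auto
      then show ?thesis using 2 by (simp add: p_def)
    next
      case 3
      then have "e (2 * h - j) < e (2 * h - i)" "e (2 * h - i) \<le> q"
        using emono[of "2 * h - j" "2 * h - i"] e1[of "2 * h - i"] that by auto
      then show ?thesis using 3 that by (simp add: p_def)
    qed
  qed
  then have mono: "strict_mono_on {1..2 * h} p" by (auto simp: strict_mono_on_def)
  have "p j \<in> {1..2 * q}" if "j \<in> {1..2 * h}" for j
  proof (cases "j \<le> h")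
    case True
    then have "1 \<le> e (j - 1)" "e (j - 1) \<le> q" using that e1[of "j - 1"] by auto
    then show ?thesis using True by (simp add: p_def)
  next
    case False
    then have "1 \<le> e (2 * h - j)" "e (2 * h - j) \<le> q" using that e1[of "2 * h - j"] by auto
    moreover have "p j = 2 * q + 1 - e (2 * h - j)" using False by (simp add: p_def)
    ultimately show ?thesis unfolding atLeastAtMost_iff by linarith
  qed
  then have ind: "swapping_indices (2 * q) h p"
    unfolding swapping_indices_def using mono h by auto
  have "swapping_couples \<kappa> h p = (\<lambda>r. (\<kappa> r, \<kappa> (2 * q + 1 - r))) ` Q" for \<kappa>
  proof -
    have Q: "Q = (\<lambda>j. e (j - 1)) ` {1..h}"
    proof -
      have "{..<h} = (\<lambda>j. j - 1) ` {1..h}"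
        by (auto simp: image_iff intro!: bexI[of _ "Suc _"])
      then have "(\<lambda>j. e (j - 1)) ` {1..h} = e ` {..<h}" by (simp add: image_image)
      then show ?thesis using e(1) by (simp add: bij_betw_def h_def)
    qed
    have couple: "(\<kappa> (p j), \<kappa> (p (2 * h - j + 1))) = (\<kappa> (e (j - 1)), \<kappa> (2 * q + 1 - e (j - 1)))"
      if "j \<in> {1..h}" for j
    proof -
      have "2 * h - (2 * h - j + 1) = j - 1" "h < 2 * h - j + 1" using that by auto
      then show ?thesis using that by (simp add: p_def)
    qed
    have "swapping_couples \<kappa> h p = (\<lambda>j. (\<kappa> (p j), \<kappa> (p (2 * h - j + 1)))) ` {1..h}"
      unfolding swapping_couples_def by (rule Setcompr_eq_image)
    also have "\<dots> = (\<lambda>j. (\<kappa> (e (j - 1)), \<kappa> (2 * q + 1 - e (j - 1)))) ` {1..h}"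
      by (rule image_cong[OF refl couple])
    also have "\<dots> = (\<lambda>r. (\<kappa> r, \<kappa> (2 * q + 1 - r))) ` Q"
      unfolding Q image_image ..
    finally show ?thesis .
  qed
  with h ind show ?thesis using that by blast
qed

section \<open>Blocks as arrays, and the movement that swaps mirror pairs\<close>

definition block :: "nat \<Rightarrow> nat \<Rightarrow> 'n \<Rightarrow> ('n::finite \<Rightarrow> nat) \<Rightarrow> (real ^ 'n) set" where
  "block N l d b = grid_box N b (\<lambda>i. if i = d then b i + l else b i + 1)"

lemma block_cells:
  assumes "0 < N" "b \<in> indices N" "b d + l \<le> N"
  shows "bij_betw (\<lambda>r. cell N (slice d b r)) {1..l} {c \<in> tiling N. c \<subseteq> block N l d b}"
proof -
  have "inj_on (\<lambda>r. cell N (slice d b r)) {1..l}"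
  proof (rule inj_onI)
    fix r r' assume r: "r \<in> {1..l}" "r' \<in> {1..l}" "cell N (slice d b r) = cell N (slice d b r')"
    then have "slice d b r d = slice d b r' d" by (simp add: cell_eq_iff[OF assms(1)])
    then show "r = r'" using r(1,2) by (auto simp: slice_def)
  qed
  moreover have "(\<lambda>r. cell N (slice d b r)) ` {1..l} = {c \<in> tiling N. c \<subseteq> block N l d b}"
  proof safe
    fix r assume "r \<in> {1..l}"
    then have "slice d b r \<in> indices N" using assms by (auto simp: indices_def slice_def)
    then show "cell N (slice d b r) \<in> tiling N" by (simp add: tiling_eq)
  next
    fix r p assume "r \<in> {1..l}" and p: "p \<in> cell N (slice d b r)"
    then have "cell N (slice d b r) \<subseteq> block N l d b"
      unfolding block_def cell_subset_iff[OF assms(1)] by (auto simp: slice_def)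
    with p show "p \<in> block N l d b" by blast
  next
    fix c :: "(real ^ 'a) set" assume "c \<in> tiling N" and sub: "c \<subseteq> block N l d b"
    then obtain x where c: "c = cell N x" by (auto simp: tiling_eq)
    have x: "b i \<le> x i \<and> x i < (if i = d then b i + l else b i + 1)" for i
      using sub unfolding c block_def cell_subset_iff[OF assms(1)] by blast
    have "x = slice d b (x d - b d + 1)"
    proof
      fix i show "x i = slice d b (x d - b d + 1) i"
        using x[of i] x[of d] by (auto simp: slice_def split: if_splits)
    qed
    moreover have "x d - b d + 1 \<in> {1..l}" using x[of d] by auto
    ultimately show "c \<in> (\<lambda>r. cell N (slice d b r)) ` {1..l}"
      unfolding c by (metis image_eqI)
  qed
  ultimately show ?thesis by (simp add: bij_betw_def)
qed

lemma block_is_array: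
  assumes "0 < N" "0 < l" "b \<in> indices N" "b d + l \<le> N"
  shows "block N l d b \<in> arrays N" "array_length N (block N l d b) = l"
    "consecutive_cubes N (block N l d b) (\<lambda>r. cell N (slice d b r))"
proof -
  have "(\<forall>i. b i < (if i = d then b i + l else b i + 1) \<and> (if i = d then b i + l else b i + 1) \<le> N) \<and>
     (\<exists>d'. \<forall>i. i \<noteq> d' \<longrightarrow> (if i = d then b i + l else b i + 1) = b i + 1)"
    using assms by (auto simp: indices_def Suc_le_eq)
  then show "block N l d b \<in> arrays N"
    unfolding arrays_def block_def by blast
  note cells = block_cells[OF assms(1,3,4)]
  show len: "array_length N (block N l d b) = l"
    using bij_betw_same_card[OF cells] by (simp add: array_length_def)
  have "center (cell N (slice d b (j + 1))) = center (cell N (slice d b j)) + axis d (1 / real N)"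
    if "1 \<le> j" for j
    using that
    by (auto simp: center_cell[OF assms(1)] vec_eq_iff slice_def axis_def of_nat_diff
        diff_divide_distrib add_divide_distrib)
  then show "consecutive_cubes N (block N l d b) (\<lambda>r. cell N (slice d b r))"
    unfolding consecutive_cubes_def len using cells by blast
qed

text \<open>An interior point of a block determines it, even on a face between two of its cells:
  \<open>locate\<close> returns the coordinates of \<open>b\<close> off \<open>d\<close>, and along
  \<open>d\<close> a number whose quotient by \<open>l\<close> recovers \<open>b d\<close>.\<close>

lemma blocks_disjoint:
  assumes "0 < N" "l dvd b d" "l dvd b' d"
    "interior (block N l d b) \<inter> interior (block N l d b') \<noteq> {}"
  shows "b = b'"
proof -
  obtain p where p: "p \<in> interior (block N l d b)" "p \<in> interior (block N l d b')"
    using assms(4) by blast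
  have loc: "x i \<le> locate N p i \<and> locate N p i < (if i = d then x i + l else x i + 1)"
    if "p \<in> interior (block N l d x)" for x i
    using locate_interior_grid_box[OF assms(1) that[unfolded block_def]] .
  have "b d = b' d"
  proof -
    have "x d = l * (locate N p d div l)" if "l dvd x d" "p \<in> interior (block N l d x)" for x
    proof -
      obtain k where k: "x d = l * k" using \<open>l dvd x d\<close> by auto
      have "l * k \<le> locate N p d" "locate N p d < l * Suc k"
        using loc[OF that(2), of d] k by simp_all
      then have "locate N p d div l = k" by (rule div_nat_eqI)
      with k show ?thesis by simp
    qed
    then show ?thesis using p assms(2,3) by metis
  qed
  moreover have "b i = b' i" if "i \<noteq> d" for i
    using loc[OF p(1), of i] loc[OF p(2), of i] that by simp
  ultimately show ?thesis by (intro ext) metis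
qed

text \<open>The arrays are all blocks in direction \<open>d\<close>, including those without
  couples, so the maximal length is exactly \<open>l\<close>. There are at most
  \<open>N ^ CARD('n)\<close> couples in total, whose square root cancels the factor
  \<open>N powr (- CARD('n) / 2)\<close> in the cost.\<close>

lemma reflect_swap_movement:
  fixes T :: "('n::finite \<Rightarrow> nat) set"
  assumes l: "l = 2 * q" "0 < q" and N: "0 < N" "l dvd N"
    and T: "T \<subseteq> indices N" "closed_under (reflect l d) T"
  obtains Z :: "real ^ 'n \<Rightarrow> real ^ 'n" and c where
    "elementary_movement N Z c" "c \<le> real l / real N" "acts_by N Z (swap_on T (reflect l d))"
proof -
  have l0: "0 < l" using l by simp
  define B where "B = {b \<in> indices N. l dvd b d}"
  have finB: "finite B" unfolding B_def by (rule finite_subset[OF _ finite_indices]) auto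
  have BN: "b d + l \<le> N" if bB: "b \<in> B" for b
  proof -
    obtain k k' where k: "b d = l * k" "N = l * k'"
      using bB N(2) unfolding B_def dvd_def by auto
    have "b d < N" using that by (auto simp: B_def indices_def)
    then have "k < k'" using k l0 by simp
    then have "l * Suc k \<le> l * k'" by (intro mult_le_mono2) simp
    then show ?thesis using k by simp
  qed
  have Bi: "b \<in> indices N" "l dvd b d" if "b \<in> B" for b using that by (auto simp: B_def)
  \<comment> \<open>Only positions in the lower half are recorded; closure of \<open>T\<close> under
    the reflection brings in their mirrors.\<close>
  define Q where "Q b = {r \<in> {1..q}. slice d b r \<in> T}" for b
  \<comment> \<open>Quantifying over \<open>\<kappa>\<close> inside \<open>R\<close> lets
    \<open>h\<close> and \<open>p\<close> be chosen from \<open>b\<close> alone.\<close>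
  define R where "R b h p \<longleftrightarrow> h \<le> q \<and> swapping_indices l h p \<and>
    (\<forall>\<kappa> :: nat \<Rightarrow> (real ^ 'n) set. swapping_couples \<kappa> h p = (\<lambda>r. (\<kappa> r, \<kappa> (l + 1 - r))) ` Q b)"
    for b h p
  have "\<forall>b. \<exists>h p. R b h p"
  proof
    fix b
    have "Q b \<subseteq> {1..q}" by (auto simp: Q_def)
    then show "\<exists>h p. R b h p"
      unfolding R_def l(1) by (rule swapping_indices_symmetric) blast
  qed
  then obtain hB pB where "\<forall>b. R b (hB b) (pB b)" by metis
  then have hp: "hB b \<le> q" "swapping_indices l (hB b) (pB b)"
    "swapping_couples \<kappa> (hB b) (pB b) = (\<lambda>r. (\<kappa> r, \<kappa> (l + 1 - r))) ` Q b"
    for b and \<kappa> :: "nat \<Rightarrow> (real ^ 'n) set"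
    unfolding R_def by blast+
  define m where "m = card B"
  obtain e where e: "bij_betw e {1..m} B"
    using ex_bij_betw_nat_finite_1[OF finB] unfolding m_def by blast
  have eB: "e i \<in> B" if "i \<in> {1..m}" for i using e that by (auto simp: bij_betw_def)
  \<comment> \<open>The block at the origin ensures that there is at least one array, as the
    definition of a movement demands.\<close>
  have "(\<lambda>_. 0) \<in> B" using N(1) by (auto simp: B_def indices_def)
  then have m1: "1 \<le> m" using finB unfolding m_def by (metis One_nat_def Suc_leI card_gt_0_iff empty_iff)
  \<comment> \<open>Each swapped pair is listed once, by its lower cell.\<close>
  define S where "S = (\<lambda>x. (cell N x, cell N (reflect l d x)) :: (real ^ 'n) set \<times> (real ^ 'n) set) ` {x \<in> T. x d mod l < q}"
  have S_eq: "(\<Union>i\<in>{1..m}. swapping_couples (\<lambda>r. cell N (slice d (e i) r)) (hB (e i)) (pB (e i))) = S"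
  proof -
    have "(\<Union>i\<in>{1..m}. swapping_couples (\<lambda>r. cell N (slice d (e i) r)) (hB (e i)) (pB (e i)))
      = (\<Union>b\<in>e ` {1..m}. (\<lambda>r. (cell N (slice d b r), cell N (slice d b (l + 1 - r)))) ` Q b)"
      by (simp add: hp(3))
    also have "e ` {1..m} = B" using e by (simp add: bij_betw_def)
    also have "(\<Union>b\<in>B. (\<lambda>r. (cell N (slice d b r), cell N (slice d b (l + 1 - r)))) ` Q b) = S"
    proof (intro equalityI subsetI)
      fix z assume "z \<in> (\<Union>b\<in>B. (\<lambda>r. (cell N (slice d b r), cell N (slice d b (l + 1 - r)))) ` Q b)"
      then obtain b r where br: "b \<in> B" "r \<in> Q b"
        "z = (cell N (slice d b r), cell N (slice d b (l + 1 - r)))" by blast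
      have r: "r \<in> {1..l}" "1 \<le> r" "r \<le> q" using br(2) l by (auto simp: Q_def)
      have "slice d b r d mod l < q" using slice_div_mod(2)[of l b d r, OF Bi(2)[OF br(1)] r(1)] r by simp
      moreover have "slice d b r \<in> T" using br(2) by (simp add: Q_def)
      ultimately show "z \<in> S"
        unfolding S_def br(3) reflect_slice[of l b d r, OF Bi(2)[OF br(1)] r(1), symmetric] by blast
    next
      fix z assume "z \<in> S"
      then obtain x where x: "x \<in> T" "x d mod l < q" "z = (cell N x, cell N (reflect l d x))"
        by (auto simp: S_def)
      define r where "r = x d mod l + 1"
      define b where "b = x(d := l * (x d div l))"
      have xi: "x \<in> indices N" using x T by auto
      have "l * (x d div l) \<le> x d" by simp
      moreover have "x d < N" using xi by (simp add: indices_def)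
      ultimately have "l * (x d div l) < N" by linarith
      then have b: "b \<in> B" using xi by (auto simp: b_def B_def indices_def)
      have sl: "slice d b r = x" by (simp add: slice_def b_def r_def)
      have r: "r \<in> Q b" using x by (auto simp: Q_def sl) (auto simp: r_def)
      then have "r \<in> {1..l}" using l by (auto simp: Q_def)
      from reflect_slice[of l b d r, OF Bi(2)[OF b] this] have "z = (cell N (slice d b r), cell N (slice d b (l + 1 - r)))"
        using x(3) by (simp add: sl)
      with b r show "z \<in> (\<Union>b\<in>B. (\<lambda>r. (cell N (slice d b r), cell N (slice d b (l + 1 - r)))) ` Q b)"
        by blast
    qed
    finally show ?thesis .
  qed
  \<comment> \<open>The interior condition fixes all points on cell faces, as
    \<open>exchanges\<close> prescribes.\<close>
  define Z where "Z p = (let x = locate N p in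
      if x \<in> T \<and> p \<in> interior (cell N x)
      then p + center (cell N (reflect l d x)) - center (cell N x) else p)" for p :: "real ^ 'n"
  have Z: "Z p = p + center (cell N (reflect l d x)) - center (cell N x)"
    if "x \<in> T" "p \<in> interior (cell N x)" for x p
    using that locate_interior_cell[OF N(1) that(2)] by (simp add: Z_def)
  have Z': "Z p = p" if "x \<notin> T" "p \<in> interior (cell N x)" for x p
    using that locate_interior_cell[OF N(1) that(2)] by (simp add: Z_def)
  have acts: "acts_by N Z (swap_on T (reflect l d))"
    unfolding acts_by_def by (simp add: swap_on_def Z Z')
  have ex: "exchanges Z S"
    unfolding exchanges_def
  proof (intro conjI ballI)
    fix z assume "z \<in> S"
    then obtain x where x: "x \<in> T" "z = (cell N x, cell N (reflect l d x))" by (auto simp: S_def)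
    have "reflect l d x \<in> T" using T(2) x(1) by (auto simp: closed_under_def)
    then show "case z of (\<kappa>, \<kappa>') \<Rightarrow> (\<forall>x\<in>interior \<kappa>. Z x = x + center \<kappa>' - center \<kappa>) \<and>
        (\<forall>x\<in>interior \<kappa>'. Z x = x + center \<kappa> - center \<kappa>')"
      using Z[of x] Z[of "reflect l d x"] x by (simp add: reflect_reflect[OF l0])
  next
    show "\<forall>x. x \<notin> (\<Union>(\<kappa>, \<kappa>')\<in>S. interior \<kappa> \<union> interior \<kappa>') \<longrightarrow> Z x = x"
    proof (intro allI impI)
      fix p assume p: "p \<notin> (\<Union>(\<kappa>, \<kappa>')\<in>S. interior \<kappa> \<union> interior \<kappa>')"
      show "Z p = p"
      proof (rule ccontr)
        assume "Z p \<noteq> p"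
        then obtain x where x: "x \<in> T" "p \<in> interior (cell N x)"
          unfolding Z_def Let_def by metis
        \<comment> \<open>Pass to the lower cell of the pair, under which \<open>S\<close> lists
          it.\<close>
        define y where "y = (if x d mod l < q then x else reflect l d x)"
        have "y \<in> T" using x(1) T(2) by (simp add: y_def closed_under_def image_subset_iff)
        moreover have "y d mod l < q" by (simp add: y_def lower_half_reflect[OF l])
        ultimately have "(cell N y, cell N (reflect l d y)) \<in> S" unfolding S_def by blast
        moreover have "p \<in> interior (cell N y) \<union> interior (cell N (reflect l d y))"
          using x(2) by (simp add: y_def reflect_reflect[OF l0])
        ultimately show False using p by blast
      qed
    qed
  qed
  define c where "c = real (Max ((\<lambda>i. array_length N (block N l d (e i))) ` {1..m})) *
            real N powr (- 1 - real CARD('n) / 2) * sqrt (real (\<Sum>i=1..m. hB (e i)))"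
  have mv: "elementary_movement N Z c"
    unfolding elementary_movement_def
  proof (rule exI[of _ m], rule exI[of _ "\<lambda>i. block N l d (e i)"],
      rule exI[of _ "\<lambda>i r. cell N (slice d (e i) r)"], rule exI[of _ "\<lambda>i. hB (e i)"],
      rule exI[of _ "\<lambda>i. pB (e i)"], intro conjI ballI impI)
    show "1 \<le> m" by (rule m1)
    show "block N l d (e i) \<in> arrays N" "consecutive_cubes N (block N l d (e i)) (\<lambda>r. cell N (slice d (e i) r))"
      "swapping_indices (array_length N (block N l d (e i))) (hB (e i)) (pB (e i))" if "i \<in> {1..m}" for i
      using block_is_array[of N l "e i" d, OF N(1) l0 Bi(1)[OF eB[OF that]] BN[OF eB[OF that]]] hp(2) by auto
    show "interior (block N l d (e i)) \<inter> interior (block N l d (e i')) = {}"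
      if i: "i \<in> {1..m}" "i' \<in> {1..m}" "i \<noteq> i'" for i i'
    proof -
      have "e i \<noteq> e i'" using inj_on_contraD[OF bij_betw_imp_inj_on[OF e] i(3,1,2)] .
      with blocks_disjoint[of N l "e i" d "e i'", OF N(1) Bi(2)[OF eB[OF i(1)]] Bi(2)[OF eB[OF i(2)]]]
      show ?thesis by argo
    qed
    show "exchanges Z (\<Union>i\<in>{1..m}. swapping_couples (\<lambda>r. cell N (slice d (e i) r)) (hB (e i)) (pB (e i)))"
      unfolding S_eq by (rule ex)
    show "c = real (Max ((\<lambda>i. array_length N (block N l d (e i))) ` {1..m})) *
            real N powr (- 1 - real CARD('n) / 2) * sqrt (real (\<Sum>i=1..m. hB (e i)))"
      by (rule c_def)
  qed
  have "c \<le> real l / real N"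
  proof -
    have "(\<lambda>i. array_length N (block N l d (e i))) ` {1..m} = (\<lambda>_. l) ` {1..m}"
      using block_is_array(2)[OF N(1) l0 Bi(1)[OF eB] BN[OF eB]] by (intro image_cong) auto
    also have "\<dots> = {l}" using m1 by auto
    finally have mx: "Max ((\<lambda>i. array_length N (block N l d (e i))) ` {1..m}) = l" by simp
    \<comment> \<open>Distinct pairs of block and position give distinct cells, which bounds the
      number of blocks.\<close>
    have "card (B \<times> {1..l}) \<le> card (indices N :: ('n \<Rightarrow> nat) set)"
    proof (rule card_inj_on_le)
      show "inj_on (\<lambda>(b, r). slice d b r) (B \<times> {1..l})"
      proof (rule inj_onI, clarify)
        fix b r b' r' assume *: "b \<in> B" "b' \<in> B" "r \<in> {1..l}" "r' \<in> {1..l}" "slice d b r = slice d b' r'"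
        note s = slice_div_mod[of l b d r, OF Bi(2)[OF *(1)] *(3)]
          slice_div_mod[of l b' d r', OF Bi(2)[OF *(2)] *(4)]
        have "r - 1 = r' - 1" "b d div l = b' d div l" using s *(5) by metis+
        then have "r = r'" "b d = b' d" using *(3,4) Bi(2)[OF *(1)] Bi(2)[OF *(2)]
          by (auto simp: dvd_div_eq_iff)
        moreover have "b i = b' i" if "i \<noteq> d" for i
          using fun_cong[OF *(5), of i] that by (simp add: slice_def)
        ultimately show "b = b' \<and> r = r'" by (metis ext)
      qed
      show "(\<lambda>(b, r). slice d b r) ` (B \<times> {1..l}) \<subseteq> indices N"
      proof (clarify)
        fix b r assume br: "b \<in> B" "r \<in> {1..l}"
        have "b d + (r - 1) < N" using BN[OF br(1)] br(2) by auto
        then show "slice d b r \<in> indices N" using Bi(1)[OF br(1)] by (auto simp: slice_def indices_def)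
      qed
    qed (rule finite_indices)
    then have "m * l \<le> N ^ CARD('n)"
      by (simp add: card_indices card_cartesian_product m_def)
    moreover have "(\<Sum>i=1..m. hB (e i)) \<le> m * q"
      using sum_bounded_above[of "{1..m}" "\<lambda>i. hB (e i)" q] hp(1) by simp
    moreover have "m * q \<le> m * l" using l by simp
    ultimately have "real (\<Sum>i=1..m. hB (e i)) \<le> real (N ^ CARD('n))"
      by (intro of_nat_mono) linarith
    then have "sqrt (real (\<Sum>i=1..m. hB (e i))) \<le> sqrt (real (N ^ CARD('n)))"
      by (rule real_sqrt_le_mono)
    also have "\<dots> = real N powr (real CARD('n) / 2)"
      using N(1) by (simp add: powr_half_sqrt[symmetric] powr_realpow[symmetric] powr_powr)
    finally have "c \<le> real l * real N powr (- 1 - real CARD('n) / 2) * real N powr (real CARD('n) / 2)"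
      unfolding c_def mx by (intro mult_left_mono) auto
    also have "\<dots> = real l / real N"
      using N(1) by (simp add: mult.assoc powr_add[symmetric] powr_minus_divide)
    finally show ?thesis .
  qed
  with mv acts show ?thesis using that by blast
qed

subsection \<open>Routing scale by scale\<close>

text \<open>The quotient by \<open>q\<close> is the quotient by \<open>2 * q\<close> followed by one
  binary digit, and that digit tells the half.\<close>

lemma div_half_eqI:
  fixes x y :: nat
  assumes "l = 2 * q" "x div l = y div l" "(x mod l < q) = (y mod l < q)" "0 < q"
  shows "x div q = y div q"
proof -
  have "z div l = z div q div 2" "(z mod l < q) = even (z div q)" for z
  proof -
    show "z div l = z div q div 2" by (simp add: assms(1) div_mult2_eq mult.commute[of 2])
    have "z mod l = q * (z div q mod 2) + z mod q" by (simp add: assms(1) mod_mult2_eq mult.commute[of 2])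
    moreover have "z mod q < q" using assms(4) by simp
    ultimately show "(z mod l < q) = even (z div q)"
      by (cases "even (z div q)") (auto simp: even_iff_mod_2_eq_zero odd_iff_mod_2_eq_one)
  qed
  with assms(2,3) have "x div q div 2 = y div q div 2" "even (x div q) = even (y div q)" by auto
  then show ?thesis by (metis div_mult_mod_eq mod2_eq_if)
qed

section \<open>Flows that undo a permutation\<close>

lemma flow_length_simps [simp]:
  "flow_length [] = 0" "flow_length ((Z, c) # F) = c + flow_length F"
  "flow_length (F @ G) = flow_length F + flow_length G"
  by (simp_all add: flow_length_def)

text \<open>The permutation \<open>\<theta>\<close> applied before \<open>\<pi>\<close> is what makes the conjugation step composable.\<close>

definition undoes :: "nat \<Rightarrow> ((real ^ 'n \<Rightarrow> real ^ 'n) \<times> real) list \<Rightarrow>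
    (('n::finite \<Rightarrow> nat) \<Rightarrow> 'n \<Rightarrow> nat) \<Rightarrow> bool" where
  "undoes N F \<pi> \<longleftrightarrow> (\<forall>f \<theta>. \<theta> \<in> indices N \<rightarrow> indices N \<longrightarrow> acts_by N f (\<pi> \<circ> \<theta>) \<longrightarrow>
     acts_by N (fold (\<lambda>(Z, c) f. Z \<circ> f) F f) \<theta>)"

text \<open>After \<open>Z\<close> the state is
  \<open>(u \<circ> \<pi> \<circ> t) \<circ> (t \<circ> \<theta>)\<close>, because \<open>t\<close>
  is an involution. Then \<open>F\<close> strips the first factor and \<open>W\<close> cancels the
  remaining \<open>t\<close>.\<close>

lemma undoes_conjugate:
  assumes N: "0 < N" and U: "acts_by N Z u" and T: "acts_by N W t"
    and maps: "\<pi> \<in> indices N \<rightarrow> indices N" "t \<in> indices N \<rightarrow> indices N"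
    and tt: "\<And>x. t (t x) = x"
    and F: "undoes N F (u \<circ> \<pi> \<circ> t)"
  shows "undoes N ((Z, b) # F @ [(W, c)]) \<pi>"
  unfolding undoes_def
proof (intro allI impI)
  fix f :: "real ^ 'a \<Rightarrow> real ^ 'a" and \<theta>
  assume \<theta>: "\<theta> \<in> indices N \<rightarrow> indices N" and f: "acts_by N f (\<pi> \<circ> \<theta>)"
  have t\<theta>: "t \<circ> \<theta> \<in> indices N \<rightarrow> indices N" using maps(2) \<theta> by auto
  have "acts_by N (Z \<circ> f) (u \<circ> (\<pi> \<circ> \<theta>))"
    by (rule acts_by_comp[OF N f U]) (use maps(1) \<theta> in auto)
  moreover have "u \<circ> (\<pi> \<circ> \<theta>) = (u \<circ> \<pi> \<circ> t) \<circ> (t \<circ> \<theta>)" by (simp add: fun_eq_iff tt)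
  ultimately have "acts_by N (fold (\<lambda>(Z, c) f. Z \<circ> f) F (Z \<circ> f)) (t \<circ> \<theta>)"
    using F t\<theta> unfolding undoes_def by metis
  from acts_by_comp[OF N this T t\<theta>]
  have "acts_by N (W \<circ> fold (\<lambda>(Z, c) f. Z \<circ> f) F (Z \<circ> f)) (t \<circ> (t \<circ> \<theta>))" .
  moreover have "t \<circ> (t \<circ> \<theta>) = \<theta>" by (simp add: fun_eq_iff tt)
  ultimately show "acts_by N (fold (\<lambda>(Z, c) f. Z \<circ> f) ((Z, b) # F @ [(W, c)]) f) \<theta>" by simp
qed

text \<open>\<open>2 ^ L i\<close> is the side in direction \<open>i\<close> of the blocks that
  \<open>\<pi>\<close> preserves; the exponents vary with \<open>i\<close> because one step halves a
  single side. Lowering an exponent from \<open>k\<close> to \<open>k - 1\<close> takes two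
  movements of cost at most \<open>2 ^ k / N\<close>, and summing \<open>2 * 2 ^ k\<close> over
  \<open>k = 1, ..., L i\<close> gives \<open>4 * (2 ^ L i - 1)\<close>.\<close>

lemma undoing_flow:
  fixes \<pi> :: "('n::finite \<Rightarrow> nat) \<Rightarrow> 'n \<Rightarrow> nat"
  assumes "N = 2 ^ n" "\<And>i. L i \<le> n" "bij_betw \<pi> (indices N) (indices N)"
    "\<And>x i. x \<in> indices N \<Longrightarrow> \<pi> x i div 2 ^ L i = x i div 2 ^ L i"
  shows "\<exists>F. discrete_flow N F \<and> flow_length F \<le> (\<Sum>i\<in>UNIV. 4 * (2 ^ L i - 1)) / real N \<and> undoes N F \<pi>"
  using assms(2-4)
proof (induction "\<Sum>i\<in>UNIV. L i" arbitrary: L \<pi> rule: less_induct)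
  case less
  have N: "0 < N" by (simp add: assms(1))
  show ?case
  proof (cases "\<forall>i. L i = 0")
    \<comment> \<open>All blocks are single cells, so \<open>\<pi>\<close> fixes every index and the
      empty flow suffices.\<close>
    case True
    then have id: "\<pi> x = x" if "x \<in> indices N" for x
      using less.prems(3)[OF that] by auto
    have "undoes N [] \<pi>"
      unfolding undoes_def
    proof (intro allI impI)
      fix f :: "real ^ 'n \<Rightarrow> real ^ 'n" and \<theta> :: "('n \<Rightarrow> nat) \<Rightarrow> 'n \<Rightarrow> nat"
      assume \<theta>: "\<theta> \<in> indices N \<rightarrow> indices N" and f: "acts_by N f (\<pi> \<circ> \<theta>)"
      have "(\<pi> \<circ> \<theta>) x = \<theta> x" if "x \<in> indices N" for x
        using id[OF funcset_mem[OF \<theta> that]] by simp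
      from acts_by_cong[OF f this] show "acts_by N (fold (\<lambda>(Z, c) f. Z \<circ> f) [] f) \<theta>" by simp
    qed
    then show ?thesis using True
      by (intro exI[of _ "[]"]) (simp add: discrete_flow_def)
  next
    case False
    then obtain d j where Ld: "L d = Suc j" by (metis not0_implies_Suc)
    define q :: nat where "q = 2 ^ j"
    define l where "l = 2 * q"
    define \<sigma> :: "('n \<Rightarrow> nat) \<Rightarrow> 'n \<Rightarrow> nat" where "\<sigma> = reflect l d"
    have q: "0 < q" by (simp add: q_def)
    then have l0: "0 < l" by (simp add: l_def)
    have lL: "l = 2 ^ L d" by (simp add: l_def q_def Ld)
    have lN: "l dvd N" unfolding lL assms(1) using less.prems(1) by (simp add: le_imp_power_dvd)
    have \<sigma>: "fpf_involution_on (indices N) \<sigma>"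
      unfolding \<sigma>_def by (rule fpf_involution_on_reflect[OF l_def q lN])
    obtain T U where TU: "T \<subseteq> indices N" "closed_under \<sigma> T" "U \<subseteq> indices N" "closed_under \<sigma> U"
      and half: "\<And>x. x \<in> indices N \<Longrightarrow>
        (swap_on U \<sigma> (\<pi> (swap_on T \<sigma> x)) d mod l < q) = (x d mod l < q)"
      using benes_step[OF finite_indices \<sigma> less.prems(2), of "\<lambda>x. x d mod l < q"]
        lower_half_reflect[OF l_def q] unfolding \<sigma>_def by metis
    define \<rho> where "\<rho> = swap_on U \<sigma> \<circ> \<pi> \<circ> swap_on T \<sigma>"
    note bijT = bij_betw_swap_on[OF \<sigma> TU(1,2)] and bijU = bij_betw_swap_on[OF \<sigma> TU(3,4)]
    have bij: "bij_betw \<rho> (indices N) (indices N)"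
      unfolding \<rho>_def by (intro bij_betw_trans[OF bijT] bij_betw_trans[OF less.prems(2)] bijU)
    define L' where "L' = L(d := j)"
    \<comment> \<open>For \<open>g k = 4 * (2 ^ k - 1)\<close> the increment is
      \<open>4 * 2 ^ j = 2 * l\<close>, exactly what the two new movements may cost.\<close>
    have sum: "(\<Sum>i\<in>UNIV. g (L i)) = (\<Sum>i\<in>UNIV. g (L' i)) + g (Suc j) - g j" for g :: "nat \<Rightarrow> real"
      by (simp add: sum.remove[of UNIV d] L'_def Ld)
    have "(\<Sum>i\<in>UNIV. L' i) < (\<Sum>i\<in>UNIV. L i)"
      by (rule sum_strict_mono_ex1) (auto simp: L'_def Ld)
    moreover have "L' i \<le> n" for i
      using less.prems(1)[of i] Ld by (auto simp: L'_def)
    moreover note bij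
    moreover have "\<rho> x i div 2 ^ L' i = x i div 2 ^ L' i" if x: "x \<in> indices N" for x i
    proof -
      \<comment> \<open>Swapping mirror pairs never leaves the old blocks, so \<open>\<rho>\<close>
        still preserves them; \<open>half\<close> then refines them in direction
        \<open>d\<close>.\<close>
      have sw: "swap_on V \<sigma> y i div 2 ^ L i = y i div 2 ^ L i" for V y i
        by (cases "i = d")
          (simp_all add: swap_on_def \<sigma>_def reflect_other reflect_div_mod[OF l0] flip: lL)
      have div: "\<rho> x i div 2 ^ L i = x i div 2 ^ L i" for i
        using less.prems(3)[OF swap_on_in[OF \<sigma> x], of T i] by (simp add: \<rho>_def sw)
      show ?thesis
      proof (cases "i = d")
        case True
        then show ?thesis
          using div_half_eqI[OF l_def _ half[OF x] q] div[of d]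
          by (simp add: L'_def \<rho>_def flip: lL q_def)
      qed (simp add: L'_def div)
    qed
    ultimately obtain F where F: "discrete_flow N F" "undoes N F \<rho>"
      "flow_length F \<le> (\<Sum>i\<in>UNIV. 4 * (2 ^ L' i - 1)) / real N"
      using less.hyps[of L' \<rho>] by blast
    obtain Z :: "real ^ 'n \<Rightarrow> real ^ 'n" and b where Z: "elementary_movement N Z b"
      "b \<le> real l / real N" "acts_by N Z (swap_on U \<sigma>)"
      using reflect_swap_movement[OF l_def q N lN TU(3)] TU(4) unfolding \<sigma>_def by metis
    obtain W :: "real ^ 'n \<Rightarrow> real ^ 'n" and c where W: "elementary_movement N W c"
      "c \<le> real l / real N" "acts_by N W (swap_on T \<sigma>)"
      using reflect_swap_movement[OF l_def q N lN TU(1)] TU(2) unfolding \<sigma>_def by metis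
    have "undoes N ((Z, b) # F @ [(W, c)]) \<pi>"
    proof (rule undoes_conjugate[OF N Z(3) W(3)])
      show "\<pi> \<in> indices N \<rightarrow> indices N" using less.prems(2) by (auto simp: bij_betw_def)
      show "swap_on T \<sigma> \<in> indices N \<rightarrow> indices N" using bijT by (auto simp: bij_betw_def)
      show "swap_on T \<sigma> (swap_on T \<sigma> x) = x" for x by (rule swap_on_swap_on[OF \<sigma> TU(1,2)])
      show "undoes N F (swap_on U \<sigma> \<circ> \<pi> \<circ> swap_on T \<sigma>)" using F(2) by (simp only: \<rho>_def)
    qed
    moreover have "discrete_flow N ((Z, b) # F @ [(W, c)])"
      using F(1) Z(1) W(1) by (auto simp: discrete_flow_def)
    moreover have "flow_length ((Z, b) # F @ [(W, c)]) \<le> (\<Sum>i\<in>UNIV. 4 * (2 ^ L i - 1)) / real N"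
    proof -
      have "b + (flow_length F + c) \<le> real l / real N + ((\<Sum>i\<in>UNIV. 4 * (2 ^ L' i - 1)) / real N + real l / real N)"
        using Z(2) W(2) F(3) by (intro add_mono)
      also have "\<dots> = ((\<Sum>i\<in>UNIV. 4 * (2 ^ L' i - 1)) + 2 * real l) / real N"
        by (simp add: add_divide_distrib)
      also have "(\<Sum>i\<in>UNIV. 4 * (2 ^ L' i - 1)) + 2 * real l = (\<Sum>i\<in>UNIV. 4 * (2 ^ L i - 1) :: real)"
        using sum[of "\<lambda>k. 4 * (2 ^ k - 1)"] by (simp add: l_def q_def)
      finally show ?thesis by simp
    qed
    ultimately show ?thesis by blast
  qed
qed

theorem theorem1p11:
  assumes "2 \<le> CARD('n::finite)"
  shows "\<exists>C>0. \<forall>(\<epsilon>::real) (\<delta>::real) (n::nat) (m::nat) (M::nat) (P :: real ^ 'n \<Rightarrow> real ^ 'n).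
           0 < \<epsilon> \<longrightarrow> 0 < \<delta> \<longrightarrow> \<delta> < 1 \<longrightarrow> m \<le> n \<longrightarrow> \<delta> powr \<epsilon> * real (2 ^ n) = real (2 ^ m) \<longrightarrow>
           real M = \<delta> powr (- \<epsilon>) \<longrightarrow>
           P \<in> cube_permutations (2 ^ n) \<longrightarrow> constant_on_tiling (2 ^ n) M P \<longrightarrow>
           perm_dist (2 ^ n) P id \<le> ereal (C * \<delta> powr \<epsilon>)"
proof (rule exI[of _ "4 * real CARD('n)"], intro conjI allI impI)
  show "0 < 4 * real CARD('n)" by simp
  fix \<epsilon> \<delta> :: real and n m M :: nat and P :: "real ^ 'n \<Rightarrow> real ^ 'n"
  assume pos: "0 < \<epsilon>" "0 < \<delta>" and mn: "m \<le> n"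
    and side: "\<delta> powr \<epsilon> * real (2 ^ n) = real (2 ^ m)" and M: "real M = \<delta> powr (- \<epsilon>)"
    and P: "P \<in> cube_permutations (2 ^ n)" "constant_on_tiling (2 ^ n) M P"
  define N :: nat where "N = 2 ^ n"
  have N: "0 < N" by (simp add: N_def)
  have \<delta>: "\<delta> powr \<epsilon> = 2 ^ m / real N" using side by (simp add: N_def field_simps)
  \<comment> \<open>One side of a coarse cube holds \<open>2 ^ m\<close> cells, so \<open>L\<close>
    starts as the constant \<open>m\<close>.\<close>
  have "real N = real (M * 2 ^ m)"
    using side pos by (simp add: M N_def powr_minus field_simps)
  then have NM: "N = M * 2 ^ m" using of_nat_eq_iff by blast
  obtain \<pi> where \<pi>: "bij_betw \<pi> (indices N) (indices N)" "acts_by N P \<pi>"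
    "\<And>x. x \<in> indices N \<Longrightarrow> image_cube P (cell N x) = cell N (\<pi> x)"
    using cube_permutation_acts_by[OF N P(1)[folded N_def]] by blast
  have "\<pi> x i div 2 ^ m = x i div 2 ^ m" if "x \<in> indices N" for x i
    using constant_on_tiling_div[OF NM N P(2)[folded N_def] that \<pi>(3)[OF that]] .
  with undoing_flow[OF N_def, of "\<lambda>_. m" \<pi>] mn \<pi>(1) obtain F :: "((real ^ 'n \<Rightarrow> real ^ 'n) \<times> real) list"
    where F: "discrete_flow N F" "undoes N F \<pi>"
      "flow_length F \<le> (\<Sum>i\<in>(UNIV :: 'n set). 4 * (2 ^ m - 1)) / real N" by blast
  \<comment> \<open>Take \<open>\<theta> = id\<close> in \<open>undoes\<close>.\<close>
  have "acts_by N (fold (\<lambda>(Z, c) f. Z \<circ> f) F P) id"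
    using F(2) \<pi>(2) unfolding undoes_def by (metis Pi_I comp_id id_apply)
  then have "flow_connects F P id"
    unfolding flow_connects_def by (rule acts_by_id_AE[OF N])
  then have "perm_dist N P id \<le> ereal (flow_length F)"
    unfolding perm_dist_def using F(1) by (intro INF_lower) simp
  also have "flow_length F \<le> 4 * real CARD('n) * \<delta> powr \<epsilon>"
  proof (rule order_trans[OF F(3)])
    \<comment> \<open>Dropping \<open>- 1\<close> in each of the \<open>CARD('n)\<close> equal terms
      leaves \<open>2 ^ m / N\<close>, which is \<open>\<delta> powr \<epsilon>\<close>.\<close>
    show "(\<Sum>i\<in>(UNIV :: 'n set). 4 * (2 ^ m - 1)) / real N \<le> 4 * real CARD('n) * \<delta> powr \<epsilon>"
      unfolding \<delta> by (simp add: divide_right_mono)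
  qed
  finally show "perm_dist (2 ^ n) P id \<le> ereal (4 * real CARD('n) * \<delta> powr \<epsilon>)"
    by (simp add: N_def)
qed

end
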